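(* Let $\mathbb{D}=(D_1\rightrightarrows D_0)$ be an internal category in $\mathcal{C}$, with source and target maps $s,t\colon D_1\to D_0$. The functor $$\mathcal{T}_{\mathbb{D}}\colon \mathcal{C}/D_0\longrightarrow \mathcal{C}/D_0,\qquad (X\xrightarrow{\gamma}D_0)\longmapsto (D_1\times_{s,D_0,\gamma}X\xrightarrow{\pi_1}D_1\xrightarrow{t}D_0),$$ sending a morphism $f\colon(X,\gamma)\to(X',\gamma')$ of $\mathcal{C}/D_0$ to $\mathrm{id}_{D_1}\times f$, extends to a monad $\mathcal{T}_{\mathbb{D}}=(\mathcal{T}_{\mathbb{D}},\eta^{\mathbb{D}},\mu^{\mathbb{D}})$ on $\mathcal{C}/D_0$. Moreover, the category $\mathrm{Alg}(\mathcal{T}_{\mathbb{D}})$ of Eilenberg--Moore algebras for $\mathcal{T}_{\mathbb{D}}$ and morphisms between them is isomorphic to the category $\mathbf{Act}_{\mathcal{C}}(\mathbb{D})$ of actions of $\mathbb{D}$.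
   Context: $\mathcal{C}$ is a fixed category with finite limits. An internal category $\mathbb{D}$ in $\mathcal{C}$ consists of objects $D_0,D_1$, source and target maps $s,t\colon D_1\to D_0$, an identity map $i\colon D_0\to D_1$ and a composition map $\mathrm{comp}\colon D_1\times_{s,D_0,t}D_1\to D_1$ (the pullback consists of composable pairs $(g,f)$ with $s(g)=t(f)$), satisfying the usual unit and associativity axioms. The object $D_1\times_{s,D_0,\gamma}X$ is the pullback of $\gamma\colon X\to D_0$ along $s$, with projections $\pi_1$ to $D_1$ and $\pi_2$ to $X$. A (left) action of $\mathbb{D}$ is a triple $(X,\gamma,\xi)$ with $X$ an object of $\mathcal{C}$, $\gamma\colon X\to D_0$ and $\xi\colon D_1\times_{s,D_0,\gamma}X\to X$ morphisms such that: (1) $\gamma\xi=t\pi_1$; (2) $\xi\circ\langle i\gamma,\mathrm{id}_X\rangle=\mathrm{id}_X$; (3) $\xi\circ(\mathrm{comp}\times\mathrm{id}_X)=\xi\circ(\mathrm{id}_{D_1}\times\xi)$, modulo the canonical isomorphism $(D_1\times_{D_0}D_1)\times_{D_0}X\cong D_1\times_{D_0}(D_1\times_{D_0}X)$; in elementwise notation, $\xi(gf,x)=\xi(g,\xi(f,x))$. A morphism of actions $h\colon(X,\gamma,\xi)\to(X',\gamma',\xi')$ is a morphism $h\colon X\to X'$ in $\mathcal{C}$ with $\gamma'h=\gamma$ and $h\xi=\xi'(\mathrm{id}_{D_1}\times h)$. Actions and their morphisms form the category $\mathbf{Act}_{\mathcal{C}}(\mathbb{D})$. *)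

theory Defs
  imports Main
begin

section \<open>Categories, functors, finite limits\<close>

text \<open>Here \<open>g \<cdot>\<^bsub>C\<^esub> f\<close> is ``g after f''; its value is only constrained when
  \<open>Dom C g = Cod C f\<close>.\<close>

record ('o, 'a) cat =
  Obj :: "'o set"
  Arr :: "'a set"
  Dom :: "'a \<Rightarrow> 'o"
  Cod :: "'a \<Rightarrow> 'o"
  Id :: "'o \<Rightarrow> 'a"
  Comp :: "'a \<Rightarrow> 'a \<Rightarrow> 'a" (infixr "\<cdot>\<index>" 70)

definition Hom :: "('o, 'a) cat \<Rightarrow> 'o \<Rightarrow> 'o \<Rightarrow> 'a set" where
  "Hom C x y = {f \<in> Arr C. Dom C f = x \<and> Cod C f = y}"

locale category =
  fixes C :: "('o, 'a) cat" (structure)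
  assumes Dom_in: "f \<in> Arr C \<Longrightarrow> Dom C f \<in> Obj C"
    and Cod_in: "f \<in> Arr C \<Longrightarrow> Cod C f \<in> Obj C"
    and Id_in: "x \<in> Obj C \<Longrightarrow> Id C x \<in> Hom C x x"
    and Comp_in: "f \<in> Hom C x y \<Longrightarrow> g \<in> Hom C y z \<Longrightarrow> g \<cdot> f \<in> Hom C x z"
    and Id_left: "f \<in> Hom C x y \<Longrightarrow> Id C y \<cdot> f = f"
    and Id_right: "f \<in> Hom C x y \<Longrightarrow> f \<cdot> Id C x = f"
    and Comp_assoc: "f \<in> Hom C w x \<Longrightarrow> g \<in> Hom C x y \<Longrightarrow> h \<in> Hom C y z \<Longrightarrow>
          (h \<cdot> g) \<cdot> f = h \<cdot> (g \<cdot> f)"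

record ('o1, 'a1, 'o2, 'a2) functor_data =
  FObj :: "'o1 \<Rightarrow> 'o2"
  FArr :: "'a1 \<Rightarrow> 'a2"

locale is_functor =
  dom: category A + cod: category B
  for A :: "('o1, 'a1) cat" and B :: "('o2, 'a2) cat"
    and F :: "('o1, 'a1, 'o2, 'a2) functor_data" +
  assumes FObj_in: "x \<in> Obj A \<Longrightarrow> FObj F x \<in> Obj B"
    and FArr_in: "f \<in> Hom A x y \<Longrightarrow> FArr F f \<in> Hom B (FObj F x) (FObj F y)"
    and FArr_Id: "x \<in> Obj A \<Longrightarrow> FArr F (Id A x) = Id B (FObj F x)"
    and FArr_Comp: "f \<in> Hom A x y \<Longrightarrow> g \<in> Hom A y z \<Longrightarrow>
          FArr F (g \<cdot>\<^bsub>A\<^esub> f) = FArr F g \<cdot>\<^bsub>B\<^esub> FArr F f"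

definition id_functor :: "('o, 'a, 'o, 'a) functor_data" where
  "id_functor = \<lparr>FObj = (\<lambda>x. x), FArr = (\<lambda>f. f)\<rparr>"

definition comp_functor ::
  "('o2, 'a2, 'o3, 'a3) functor_data \<Rightarrow> ('o1, 'a1, 'o2, 'a2) functor_data \<Rightarrow>
   ('o1, 'a1, 'o3, 'a3) functor_data" where
  "comp_functor G F = \<lparr>FObj = FObj G \<circ> FObj F, FArr = FArr G \<circ> FArr F\<rparr>"

locale nat_transformation =
  source: is_functor A B F + target: is_functor A B G
  for A :: "('o1, 'a1) cat" and B :: "('o2, 'a2) cat"
    and F G :: "('o1, 'a1, 'o2, 'a2) functor_data" and \<tau> :: "'o1 \<Rightarrow> 'a2" +
  assumes component: "x \<in> Obj A \<Longrightarrow> \<tau> x \<in> Hom B (FObj F x) (FObj G x)"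
    and naturality: "f \<in> Hom A x y \<Longrightarrow>
          \<tau> y \<cdot>\<^bsub>B\<^esub> FArr F f = FArr G f \<cdot>\<^bsub>B\<^esub> \<tau> x"

definition isomorphic_categories :: "('o1, 'a1) cat \<Rightarrow> ('o2, 'a2) cat \<Rightarrow> bool" where
  "isomorphic_categories A B \<longleftrightarrow>
     (\<exists>F G. is_functor A B F \<and> is_functor B A G \<and>
        (\<forall>x\<in>Obj A. FObj G (FObj F x) = x) \<and> (\<forall>f\<in>Arr A. FArr G (FArr F f) = f) \<and>
        (\<forall>y\<in>Obj B. FObj F (FObj G y) = y) \<and> (\<forall>g\<in>Arr B. FArr F (FArr G g) = g))"

definition is_cone ::
  "('j, 'k) cat \<Rightarrow> ('o, 'a) cat \<Rightarrow> ('j, 'k, 'o, 'a) functor_data \<Rightarrow> 'o \<Rightarrow> ('j \<Rightarrow> 'a) \<Rightarrow> bool" where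
  "is_cone J C F c l \<longleftrightarrow> c \<in> Obj C \<and> (\<forall>j\<in>Obj J. l j \<in> Hom C c (FObj F j)) \<and>
     (\<forall>u\<in>Arr J. FArr F u \<cdot>\<^bsub>C\<^esub> l (Dom J u) = l (Cod J u))"

definition is_limit ::
  "('j, 'k) cat \<Rightarrow> ('o, 'a) cat \<Rightarrow> ('j, 'k, 'o, 'a) functor_data \<Rightarrow> 'o \<Rightarrow> ('j \<Rightarrow> 'a) \<Rightarrow> bool" where
  "is_limit J C F c l \<longleftrightarrow> is_cone J C F c l \<and>
     (\<forall>d m. is_cone J C F d m \<longrightarrow>
        (\<exists>!w. w \<in> Hom C d c \<and> (\<forall>j\<in>Obj J. l j \<cdot>\<^bsub>C\<^esub> w = m j)))"

text \<open>Every finite category is isomorphic to one whose objects and arrows are natural numbers,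
  so it suffices to consider diagrams of such shapes.\<close>

definition has_finite_limits :: "('o, 'a) cat \<Rightarrow> bool" where
  "has_finite_limits C \<longleftrightarrow>
     (\<forall>(J :: (nat, nat) cat) F. finite (Obj J) \<and> finite (Arr J) \<and> is_functor J C F \<longrightarrow>
        (\<exists>c l. is_limit J C F c l))"


section \<open>Chosen pullbacks\<close>

text \<open>\<open>is_pullback C f g p q\<close>: the square \<open>f \<cdot> p = g \<cdot> q\<close> is a pullback of the cospan \<open>(f, g)\<close>;
  its vertex is the common domain of \<open>p\<close> and \<open>q\<close>.\<close>

definition is_pullback :: "('o, 'a) cat \<Rightarrow> 'a \<Rightarrow> 'a \<Rightarrow> 'a \<Rightarrow> 'a \<Rightarrow> bool" where
  "is_pullback C f g p q \<longleftrightarrow>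
     f \<in> Arr C \<and> g \<in> Arr C \<and> Cod C f = Cod C g \<and>
     p \<in> Hom C (Dom C p) (Dom C f) \<and> q \<in> Hom C (Dom C p) (Dom C g) \<and>
     f \<cdot>\<^bsub>C\<^esub> p = g \<cdot>\<^bsub>C\<^esub> q \<and>
     (\<forall>z u v. u \<in> Hom C z (Dom C f) \<and> v \<in> Hom C z (Dom C g) \<and> f \<cdot>\<^bsub>C\<^esub> u = g \<cdot>\<^bsub>C\<^esub> v \<longrightarrow>
        (\<exists>!w. w \<in> Hom C z (Dom C p) \<and> p \<cdot>\<^bsub>C\<^esub> w = u \<and> q \<cdot>\<^bsub>C\<^esub> w = v))"

text \<open>Speaking of ``the'' pullback presupposes a choice of one pullback square for each cospan.
  The choice is an arbitrary function \<open>PB\<close>, sending \<open>(f, g)\<close> to the pair of projections.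
  In a category with finite limits a choice always exists (lemma \<open>pullback_choice_exists\<close>).\<close>

type_synonym 'a pb_choice = "'a \<Rightarrow> 'a \<Rightarrow> 'a \<times> 'a"

definition pullback_choice :: "('o, 'a) cat \<Rightarrow> 'a pb_choice \<Rightarrow> bool" where
  "pullback_choice C PB \<longleftrightarrow>
     (\<forall>f\<in>Arr C. \<forall>g\<in>Arr C. Cod C f = Cod C g \<longrightarrow>
        is_pullback C f g (fst (PB f g)) (snd (PB f g)))"

abbreviation proj1 :: "'a pb_choice \<Rightarrow> 'a \<Rightarrow> 'a \<Rightarrow> 'a" where
  "proj1 PB f g \<equiv> fst (PB f g)"

abbreviation proj2 :: "'a pb_choice \<Rightarrow> 'a \<Rightarrow> 'a \<Rightarrow> 'a" where
  "proj2 PB f g \<equiv> snd (PB f g)"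

abbreviation pb_obj :: "('o, 'a) cat \<Rightarrow> 'a pb_choice \<Rightarrow> 'a \<Rightarrow> 'a \<Rightarrow> 'o" where
  "pb_obj C PB f g \<equiv> Dom C (proj1 PB f g)"

text \<open>The induced arrow \<open>\<langle>u, v\<rangle>\<close> into the chosen pullback of \<open>(f, g)\<close>; meaningful only
  when \<open>f \<cdot> u = g \<cdot> v\<close>.\<close>

definition pb_pair :: "('o, 'a) cat \<Rightarrow> 'a pb_choice \<Rightarrow> 'a \<Rightarrow> 'a \<Rightarrow> 'a \<Rightarrow> 'a \<Rightarrow> 'a" where
  "pb_pair C PB f g u v =
     (THE w. w \<in> Hom C (Dom C u) (pb_obj C PB f g) \<and>
             proj1 PB f g \<cdot>\<^bsub>C\<^esub> w = u \<and> proj2 PB f g \<cdot>\<^bsub>C\<^esub> w = v)"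

text \<open>The arrow \<open>a \<times> b\<close> from the chosen pullback of \<open>(f, g)\<close> to that of \<open>(f', g')\<close>.\<close>

definition pb_map ::
  "('o, 'a) cat \<Rightarrow> 'a pb_choice \<Rightarrow> 'a \<times> 'a \<Rightarrow> 'a \<times> 'a \<Rightarrow> 'a \<Rightarrow> 'a \<Rightarrow> 'a" where
  "pb_map C PB = (\<lambda>(f, g) (f', g') a b.
     pb_pair C PB f' g' (a \<cdot>\<^bsub>C\<^esub> proj1 PB f g) (b \<cdot>\<^bsub>C\<^esub> proj2 PB f g))"


section \<open>Internal categories and their actions\<close>

record ('o, 'a) internal_cat =
  D0 :: "'o"
  D1 :: "'o"
  src :: "'a"
  tgt :: "'a"
  ident :: "'a"
  cmp :: "'a"

text \<open>For \<open>\<gamma> : X \<rightarrow> D0\<close>, the canonical isomorphism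
  \<open>(D1 \<times> D1) \<times> X \<rightarrow> D1 \<times> (D1 \<times> X)\<close>, \<open>((g, f), x) \<mapsto> (g, (f, x))\<close>, all products being over \<open>D0\<close>.
  Thus \<open>D1 \<times> D1\<close> maps to \<open>D0\<close> by \<open>(g, f) \<mapsto> s f\<close>, and \<open>D1 \<times> X\<close> by \<open>(f, x) \<mapsto> t f\<close>.\<close>

definition assoc_iso ::
  "('o, 'a) cat \<Rightarrow> 'a pb_choice \<Rightarrow> ('o, 'a) internal_cat \<Rightarrow> 'a \<Rightarrow> 'a" where
  "assoc_iso C PB D \<gamma> =
     (let s = src D; t = tgt D;
          l = s \<cdot>\<^bsub>C\<^esub> proj2 PB s t;
          gf = proj1 PB l \<gamma>; x = proj2 PB l \<gamma>;
          g = proj1 PB s t \<cdot>\<^bsub>C\<^esub> gf; f = proj2 PB s t \<cdot>\<^bsub>C\<^esub> gf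
      in pb_pair C PB s (t \<cdot>\<^bsub>C\<^esub> proj1 PB s \<gamma>) g (pb_pair C PB s \<gamma> f x))"

text \<open>Both arrows \<open>(D1 \<times> D1) \<times> X \<rightarrow> X\<close> in the associativity law for a map \<open>\<xi> : D1 \<times> X \<rightarrow> X\<close>
  over \<open>\<gamma>\<close>: \<open>\<xi> \<cdot> (cmp \<times> id) = \<xi> \<cdot> (id \<times> \<xi>) \<cdot> assoc_iso\<close>. Associativity of \<open>cmp\<close> itself
  is the instance \<open>\<gamma> = tgt\<close>, \<open>\<xi> = cmp\<close>.\<close>

definition assoc_law ::
  "('o, 'a) cat \<Rightarrow> 'a pb_choice \<Rightarrow> ('o, 'a) internal_cat \<Rightarrow> 'a \<Rightarrow> 'a \<Rightarrow> bool" where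
  "assoc_law C PB D \<gamma> \<xi> \<longleftrightarrow>
     (let s = src D; t = tgt D in
      \<xi> \<cdot>\<^bsub>C\<^esub> pb_map C PB (s \<cdot>\<^bsub>C\<^esub> proj2 PB s t, \<gamma>) (s, \<gamma>) (cmp D) (Id C (Dom C \<gamma>)) =
      \<xi> \<cdot>\<^bsub>C\<^esub> pb_map C PB (s, t \<cdot>\<^bsub>C\<^esub> proj1 PB s \<gamma>) (s, \<gamma>) (Id C (D1 D)) \<xi>
        \<cdot>\<^bsub>C\<^esub> assoc_iso C PB D \<gamma>)"

definition internal_category ::
  "('o, 'a) cat \<Rightarrow> 'a pb_choice \<Rightarrow> ('o, 'a) internal_cat \<Rightarrow> bool" where
  "internal_category C PB D \<longleftrightarrow>
     (let s = src D; t = tgt D; i = ident D; c = cmp D in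
      D0 D \<in> Obj C \<and> D1 D \<in> Obj C \<and>
      s \<in> Hom C (D1 D) (D0 D) \<and> t \<in> Hom C (D1 D) (D0 D) \<and>
      i \<in> Hom C (D0 D) (D1 D) \<and> c \<in> Hom C (pb_obj C PB s t) (D1 D) \<and>
      s \<cdot>\<^bsub>C\<^esub> i = Id C (D0 D) \<and> t \<cdot>\<^bsub>C\<^esub> i = Id C (D0 D) \<and>
      s \<cdot>\<^bsub>C\<^esub> c = s \<cdot>\<^bsub>C\<^esub> proj2 PB s t \<and> t \<cdot>\<^bsub>C\<^esub> c = t \<cdot>\<^bsub>C\<^esub> proj1 PB s t \<and>
      c \<cdot>\<^bsub>C\<^esub> pb_pair C PB s t (i \<cdot>\<^bsub>C\<^esub> t) (Id C (D1 D)) = Id C (D1 D) \<and>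
      c \<cdot>\<^bsub>C\<^esub> pb_pair C PB s t (Id C (D1 D)) (i \<cdot>\<^bsub>C\<^esub> s) = Id C (D1 D) \<and>
      assoc_law C PB D t c)"

definition is_action ::
  "('o, 'a) cat \<Rightarrow> 'a pb_choice \<Rightarrow> ('o, 'a) internal_cat \<Rightarrow> 'o \<times> 'a \<times> 'a \<Rightarrow> bool" where
  "is_action C PB D = (\<lambda>(X, \<gamma>, \<xi>).
     X \<in> Obj C \<and> \<gamma> \<in> Hom C X (D0 D) \<and> \<xi> \<in> Hom C (pb_obj C PB (src D) \<gamma>) X \<and>
     \<gamma> \<cdot>\<^bsub>C\<^esub> \<xi> = tgt D \<cdot>\<^bsub>C\<^esub> proj1 PB (src D) \<gamma> \<and>
     \<xi> \<cdot>\<^bsub>C\<^esub> pb_pair C PB (src D) \<gamma> (ident D \<cdot>\<^bsub>C\<^esub> \<gamma>) (Id C X) = Id C X \<and>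
     assoc_law C PB D \<gamma> \<xi>)"

definition is_action_morphism ::
  "('o, 'a) cat \<Rightarrow> 'a pb_choice \<Rightarrow> ('o, 'a) internal_cat \<Rightarrow>
   'o \<times> 'a \<times> 'a \<Rightarrow> 'o \<times> 'a \<times> 'a \<Rightarrow> 'a \<Rightarrow> bool" where
  "is_action_morphism C PB D = (\<lambda>(X, \<gamma>, \<xi>) (X', \<gamma>', \<xi>') h.
     h \<in> Hom C X X' \<and> \<gamma>' \<cdot>\<^bsub>C\<^esub> h = \<gamma> \<and>
     h \<cdot>\<^bsub>C\<^esub> \<xi> = \<xi>' \<cdot>\<^bsub>C\<^esub> pb_map C PB (src D, \<gamma>) (src D, \<gamma>') (Id C (D1 D)) h)"

text \<open>In the categories built below, an arrow is a triple (domain, codomain, underlying arrow),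
  so that domain and codomain are determined by the arrow.\<close>

definition Act ::
  "('o, 'a) cat \<Rightarrow> 'a pb_choice \<Rightarrow> ('o, 'a) internal_cat \<Rightarrow>
   ('o \<times> 'a \<times> 'a, ('o \<times> 'a \<times> 'a) \<times> ('o \<times> 'a \<times> 'a) \<times> 'a) cat" where
  "Act C PB D =
     \<lparr>Obj = {x. is_action C PB D x},
      Arr = {(x, y, h). is_action C PB D x \<and> is_action C PB D y \<and> is_action_morphism C PB D x y h},
      Dom = (\<lambda>(x, y, h). x),
      Cod = (\<lambda>(x, y, h). y),
      Id = (\<lambda>x. (x, x, Id C (fst x))),
      Comp = (\<lambda>(y', z, k) (x, y, h). (x, z, k \<cdot>\<^bsub>C\<^esub> h))\<rparr>"


section \<open>Slice categories, monads, Eilenberg--Moore algebras\<close>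

text \<open>An object \<open>(X, \<gamma> : X \<rightarrow> b)\<close> of the slice \<open>C/b\<close> is represented by \<open>\<gamma>\<close>, as \<open>X = Dom C \<gamma>\<close>.\<close>

definition slice :: "('o, 'a) cat \<Rightarrow> 'o \<Rightarrow> ('a, 'a \<times> 'a \<times> 'a) cat" where
  "slice C b =
     \<lparr>Obj = {\<gamma> \<in> Arr C. Cod C \<gamma> = b},
      Arr = {(\<gamma>, \<gamma>', h). \<gamma> \<in> Arr C \<and> Cod C \<gamma> = b \<and> \<gamma>' \<in> Arr C \<and> Cod C \<gamma>' = b \<and>
               h \<in> Hom C (Dom C \<gamma>) (Dom C \<gamma>') \<and> \<gamma>' \<cdot>\<^bsub>C\<^esub> h = \<gamma>},
      Dom = (\<lambda>(\<gamma>, \<gamma>', h). \<gamma>),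
      Cod = (\<lambda>(\<gamma>, \<gamma>', h). \<gamma>'),
      Id = (\<lambda>\<gamma>. (\<gamma>, \<gamma>, Id C (Dom C \<gamma>))),
      Comp = (\<lambda>(\<gamma>1, \<gamma>'', k) (\<gamma>, \<gamma>', h). (\<gamma>, \<gamma>'', k \<cdot>\<^bsub>C\<^esub> h))\<rparr>"

locale monad =
  endo: is_functor B B T +
  unit: nat_transformation B B id_functor T \<eta> +
  mult: nat_transformation B B "comp_functor T T" T \<mu>
  for B :: "('o, 'a) cat" and T :: "('o, 'a, 'o, 'a) functor_data"
    and \<eta> \<mu> :: "'o \<Rightarrow> 'a" +
  assumes unit_left: "x \<in> Obj B \<Longrightarrow> \<mu> x \<cdot>\<^bsub>B\<^esub> \<eta> (FObj T x) = Id B (FObj T x)"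
    and unit_right: "x \<in> Obj B \<Longrightarrow> \<mu> x \<cdot>\<^bsub>B\<^esub> FArr T (\<eta> x) = Id B (FObj T x)"
    and mult_assoc: "x \<in> Obj B \<Longrightarrow>
          \<mu> x \<cdot>\<^bsub>B\<^esub> \<mu> (FObj T x) = \<mu> x \<cdot>\<^bsub>B\<^esub> FArr T (\<mu> x)"

definition is_algebra ::
  "('o, 'a) cat \<Rightarrow> ('o, 'a, 'o, 'a) functor_data \<Rightarrow> ('o \<Rightarrow> 'a) \<Rightarrow> ('o \<Rightarrow> 'a) \<Rightarrow> 'o \<times> 'a \<Rightarrow> bool" where
  "is_algebra B T \<eta> \<mu> = (\<lambda>(x, a).
     x \<in> Obj B \<and> a \<in> Hom B (FObj T x) x \<and>
     a \<cdot>\<^bsub>B\<^esub> \<eta> x = Id B x \<and> a \<cdot>\<^bsub>B\<^esub> \<mu> x = a \<cdot>\<^bsub>B\<^esub> FArr T a)"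

definition Alg ::
  "('o, 'a) cat \<Rightarrow> ('o, 'a, 'o, 'a) functor_data \<Rightarrow> ('o \<Rightarrow> 'a) \<Rightarrow> ('o \<Rightarrow> 'a) \<Rightarrow>
   ('o \<times> 'a, ('o \<times> 'a) \<times> ('o \<times> 'a) \<times> 'a) cat" where
  "Alg B T \<eta> \<mu> =
     \<lparr>Obj = {A. is_algebra B T \<eta> \<mu> A},
      Arr = {((x, a), (y, b), h). is_algebra B T \<eta> \<mu> (x, a) \<and> is_algebra B T \<eta> \<mu> (y, b) \<and>
               h \<in> Hom B x y \<and> h \<cdot>\<^bsub>B\<^esub> a = b \<cdot>\<^bsub>B\<^esub> FArr T h},
      Dom = (\<lambda>(A, A', h). A),
      Cod = (\<lambda>(A, A', h). A'),
      Id = (\<lambda>A. (A, A, Id B (fst A))),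
      Comp = (\<lambda>(A1, A'', k) (A, A', h). (A, A'', k \<cdot>\<^bsub>B\<^esub> h))\<rparr>"

definition T_functor ::
  "('o, 'a) cat \<Rightarrow> 'a pb_choice \<Rightarrow> ('o, 'a) internal_cat \<Rightarrow>
   ('a, 'a \<times> 'a \<times> 'a, 'a, 'a \<times> 'a \<times> 'a) functor_data" where
  "T_functor C PB D =
     (let T = (\<lambda>\<gamma>. tgt D \<cdot>\<^bsub>C\<^esub> proj1 PB (src D) \<gamma>) in
      \<lparr>FObj = T,
       FArr = (\<lambda>(\<gamma>, \<gamma>', f).
         (T \<gamma>, T \<gamma>', pb_map C PB (src D, \<gamma>) (src D, \<gamma>') (Id C (D1 D)) f))\<rparr>)"


section \<open>Existence of chosen pullbacks\<close>

lemma pullback_exists: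
  fixes C (structure)
  assumes "category C" and lim: "has_finite_limits C"
    and f: "f \<in> Arr C" and g: "g \<in> Arr C" and fg: "Cod C f = Cod C g"
  shows "\<exists>p q. is_pullback C f g p q"
proof -
  interpret category C by fact
  define J :: "(nat, nat) cat" where
    "J = \<lparr>Obj = {0, 1, 2}, Arr = {0, 1, 2, 3, 4},
          Dom = (\<lambda>u. if u = 3 then 0 else if u = 4 then 1 else u),
          Cod = (\<lambda>u. if u = 3 \<or> u = 4 then 2 else u),
          Id = (\<lambda>j. j), Comp = (\<lambda>v u. if v \<le> 2 then u else v)\<rparr>"
  define F where
    "F = \<lparr>FObj = (\<lambda>j::nat. if j = 0 then Dom C f else if j = 1 then Dom C g else Cod C f),
          FArr = (\<lambda>u::nat. if u = 3 then f else if u = 4 then g else if u = 0 then Id C (Dom C f)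
                   else if u = 1 then Id C (Dom C g) else Id C (Cod C f))\<rparr>"
  have ob: "Dom C f \<in> Obj C" "Dom C g \<in> Obj C" "Cod C f \<in> Obj C" "Cod C g \<in> Obj C"
    using f g Dom_in Cod_in by auto
  have h: "f \<in> Hom C (Dom C f) (Cod C f)" "g \<in> Hom C (Dom C g) (Cod C f)"
    using f g fg by (auto simp: Hom_def)
  have ids: "Id C (Dom C f) \<in> Hom C (Dom C f) (Dom C f)"
    "Id C (Dom C g) \<in> Hom C (Dom C g) (Dom C g)" "Id C (Cod C f) \<in> Hom C (Cod C f) (Cod C f)"
    using ob Id_in by auto
  have J: "category J"
  proof
    show "(x \<cdot>\<^bsub>J\<^esub> v) \<cdot>\<^bsub>J\<^esub> u = x \<cdot>\<^bsub>J\<^esub> (v \<cdot>\<^bsub>J\<^esub> u)" for x v u by (simp add: J_def)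
    show "v \<cdot>\<^bsub>J\<^esub> u \<in> Hom J i k" if u: "u \<in> Hom J i j" and v: "v \<in> Hom J j k" for u v i j k
    proof (cases "v \<le> 2")
      case True
      then have "j = k" using v by (auto simp: J_def Hom_def)
      then show ?thesis using u True by (simp add: J_def)
    next
      case False
      then have "j = 0 \<or> j = 1" using v by (auto simp: J_def Hom_def split: if_splits)
      then have "i = j" using u by (auto simp: J_def Hom_def split: if_splits)
      then show ?thesis using v False by (simp add: J_def)
    qed
    show "Id J j \<cdot>\<^bsub>J\<^esub> u = u" if "u \<in> Hom J i j" for u i j
      using that by (auto simp: J_def Hom_def split: if_splits)
    show "u \<cdot>\<^bsub>J\<^esub> Id J i = u" if "u \<in> Hom J i j" for u i j
      using that by (auto simp: J_def Hom_def split: if_splits)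
  qed (auto simp: J_def Hom_def)
  interpret J: category J by (rule J)
  have "is_functor J C F"
  proof
    have FH: "FArr F u \<in> Hom C (FObj F (Dom J u)) (FObj F (Cod J u))" if "u \<in> Arr J" for u
    proof -
      from that consider "u = 0" | "u = 1" | "u = 2" | "u = 3" | "u = 4" by (auto simp: J_def)
      then show ?thesis using h ids by cases (simp_all add: J_def F_def)
    qed
    show FA: "FArr F u \<in> Hom C (FObj F i) (FObj F j)" if "u \<in> Hom J i j" for u i j
      using FH[of u] that by (auto simp: Hom_def)
    show "FObj F j \<in> Obj C" if "j \<in> Obj J" for j
      using that ob by (simp add: F_def)
    show FI: "FArr F (Id J j) = Id C (FObj F j)" if "j \<in> Obj J" for j
      using that by (auto simp: J_def F_def)
    show "FArr F (v \<cdot>\<^bsub>J\<^esub> u) = FArr F v \<cdot> FArr F u"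
      if u: "u \<in> Hom J i j" and v: "v \<in> Hom J j k" for u v i j k
    proof (cases "v \<le> 2")
      case True
      then have "v = Id J j" "j \<in> Obj J" using v by (auto simp: J_def Hom_def)
      then have "FArr F v = Id C (FObj F j)" using FI by simp
      then show ?thesis using Id_left[OF FA[OF u]] True by (simp add: J_def)
    next
      case False
      then have "j = 0 \<or> j = 1" using v by (auto simp: J_def Hom_def split: if_splits)
      then have "i = j" "u = Id J j" "j \<in> Obj J" using u by (auto simp: J_def Hom_def split: if_splits)
      then have "FArr F u = Id C (FObj F j)" using FI by simp
      then show ?thesis using Id_right[OF FA[OF v]] False by (simp add: J_def)
    qed
  qed
  moreover have "finite (Obj J)" "finite (Arr J)" by (auto simp: J_def)
  ultimately obtain c l where L: "is_limit J C F c l"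
    using lim unfolding has_finite_limits_def by blast
  define p where "p = l 0"
  define q where "q = l 1"
  have cone: "is_cone J C F c l" using L by (simp add: is_limit_def)
  have pq: "p \<in> Hom C c (Dom C f)" "q \<in> Hom C c (Dom C g)"
    and l2: "f \<cdot> p = l 2" "g \<cdot> q = l 2"
    using cone by (auto simp: is_cone_def J_def F_def p_def q_def)
  have dp: "Dom C p = c" using pq by (simp add: Hom_def)
  have univ: "\<exists>!w. w \<in> Hom C z c \<and> p \<cdot> w = u \<and> q \<cdot> w = v"
    if u: "u \<in> Hom C z (Dom C f)" and v: "v \<in> Hom C z (Dom C g)" and uv: "f \<cdot> u = g \<cdot> v" for z u v
  proof -
    define m where "m = (\<lambda>j::nat. if j = 0 then u else if j = 1 then v else f \<cdot> u)"
    have z: "z \<in> Obj C" using u Dom_in by (auto simp: Hom_def)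
    have fu: "f \<cdot> u \<in> Hom C z (Cod C f)" using Comp_in u h by blast
    have "is_cone J C F z m"
      using z u v fu uv Id_left[OF u] Id_left[OF v] Id_left[OF fu]
      by (auto simp: is_cone_def J_def F_def m_def)
    then have ex: "\<exists>!w. w \<in> Hom C z c \<and> (\<forall>j\<in>Obj J. l j \<cdot> w = m j)"
      using L unfolding is_limit_def by blast
    have "(w \<in> Hom C z c \<and> (\<forall>j\<in>Obj J. l j \<cdot> w = m j)) \<longleftrightarrow>
          (w \<in> Hom C z c \<and> p \<cdot> w = u \<and> q \<cdot> w = v)" for w
    proof -
      have "l 2 \<cdot> w = f \<cdot> (p \<cdot> w)" if "w \<in> Hom C z c"
        using Comp_assoc[OF that pq(1) h(1)] l2 by simp
      then show ?thesis by (auto simp: J_def m_def p_def q_def)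
    qed
    then show ?thesis using ex by simp
  qed
  have "is_pullback C f g p q"
    unfolding is_pullback_def using f g fg pq l2 univ by (auto simp: dp)
  then show ?thesis by blast
qed

lemma pullback_choice_exists:
  assumes "category C" "has_finite_limits C"
  shows "\<exists>PB. pullback_choice C PB"
proof -
  have "is_pullback C f g (fst (SOME r. is_pullback C f g (fst r) (snd r)))
                          (snd (SOME r. is_pullback C f g (fst r) (snd r)))"
    if "f \<in> Arr C" "g \<in> Arr C" "Cod C f = Cod C g" for f g
  proof -
    have "\<exists>r. is_pullback C f g (fst r) (snd r)"
      using pullback_exists[OF assms that] by auto
    then show ?thesis by (rule someI_ex)
  qed
  then show ?thesis
    unfolding pullback_choice_def
    by (intro exI[of _ "\<lambda>f g. SOME r. is_pullback C f g (fst r) (snd r)"]) blast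
qed

end

theory Submission
  imports Defs
begin

text \<open>An arrow \<open>Z \<rightarrow> Y\<close> is treated as an element of \<open>Y\<close> at stage \<open>Z\<close>, and composing it with an arrow
  \<open>Z' \<rightarrow> Z\<close> as a change of stage.  Elements of the pullback
  \<open>D1 \<times> X\<close> over \<open>D0\<close> are then pairs \<open>(g, x)\<close> with \<open>s g = \<gamma> x\<close>, two arrows out of \<open>D1 \<times> X\<close> agree as
  soon as they agree on the generic pair, formed by the two projections, and pairing commutes with
  the change of stage.  The composition map of \<open>D\<close> gives an operation \<open>h \<star> g\<close> on elements of \<open>D1\<close>
  with \<open>s h = t g\<close>.  The axioms of an internal category say exactly that the elements of \<open>D0\<close>
  and \<open>D1\<close> at each stage are the objects and arrows of an ordinary category, with \<open>\<star>\<close> as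
  composition; only associativity takes some work
  (lemma \<open>assoc_law_iff\<close>), since it is given as an equation between arrows out of an iterated
  pullback, mediated by the canonical isomorphism.

  The unit and multiplication of the monad are \<open>x \<mapsto> (1, x)\<close> and \<open>(h, (g, x)) \<mapsto> (h \<star> g, x)\<close>.  On
  elements, the three monad laws are the unit laws and the associativity of \<open>\<star>\<close>
  (lemma \<open>T_monad\<close>).

  An algebra on \<open>\<gamma> : X \<rightarrow> D0\<close> is an arrow \<open>\<xi> : D1 \<times> X \<rightarrow> X\<close> over \<open>D0\<close>, which is to say \<open>\<gamma> \<xi> = t \<pi>1\<close>.
  Its unit law is literally that of an action.  Its associativity law, evaluated on a triple
  \<open>(h, (g, x))\<close>, is \<open>\<xi>(h \<star> g, x) = \<xi>(h, \<xi>(g, x))\<close>, and this is the associativity law of an action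
  as well (lemmas \<open>algebra_assoc_iff\<close> and \<open>assoc_law_iff\<close>).  Morphisms of algebras and of
  actions satisfy the same equation.  So algebras and actions are the same data, packed differently,
  and the repacking is an isomorphism of categories.\<close>


section \<open>Categories\<close>

text \<open>The category laws are restated with \<open>Dom\<close> and \<open>Cod\<close> instead of hom-sets: the side
  conditions then contain no variables beyond those of the rewritten term, so that rewriting can
  compute the type of a composite and bring it into right-nested form.\<close>

context category
begin

lemma comp_simps [simp]:
  assumes "f \<in> Arr C" "g \<in> Arr C" "Dom C g = Cod C f"
  shows "g \<cdot> f \<in> Arr C" "Dom C (g \<cdot> f) = Dom C f" "Cod C (g \<cdot> f) = Cod C g"
  using Comp_in[of f "Dom C f" "Cod C f" g "Cod C g"] assms by (auto simp: Hom_def)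

lemma comp_assoc [simp]:
  assumes "f \<in> Arr C" "g \<in> Arr C" "h \<in> Arr C" "Dom C g = Cod C f" "Dom C h = Cod C g"
  shows "(h \<cdot> g) \<cdot> f = h \<cdot> (g \<cdot> f)"
  using Comp_assoc[of f "Dom C f" "Cod C f" g "Cod C g" h "Cod C h"] assms by (auto simp: Hom_def)

lemma id_simps [simp]:
  assumes "x \<in> Obj C"
  shows "Id C x \<in> Arr C" "Dom C (Id C x) = x" "Cod C (Id C x) = x"
  using Id_in[OF assms] by (auto simp: Hom_def)

lemma comp_id [simp]:
  assumes "f \<in> Arr C"
  shows "Cod C f = x \<Longrightarrow> Id C x \<cdot> f = f" "Dom C f = x \<Longrightarrow> f \<cdot> Id C x = f"
  using Id_left[of f "Dom C f" "Cod C f"] Id_right[of f "Dom C f" "Cod C f"] assms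
  by (auto simp: Hom_def)

lemmas dom_cod_in [simp] = Dom_in Cod_in

end

lemma categoryI:
  fixes C (structure)
  assumes "\<And>f. f \<in> Arr C \<Longrightarrow> Dom C f \<in> Obj C \<and> Cod C f \<in> Obj C"
    and "\<And>x. x \<in> Obj C \<Longrightarrow> Id C x \<in> Arr C \<and> Dom C (Id C x) = x \<and> Cod C (Id C x) = x"
    and "\<And>f g. f \<in> Arr C \<Longrightarrow> g \<in> Arr C \<Longrightarrow> Cod C f = Dom C g \<Longrightarrow>
           g \<cdot> f \<in> Arr C \<and> Dom C (g \<cdot> f) = Dom C f \<and> Cod C (g \<cdot> f) = Cod C g"
    and "\<And>f. f \<in> Arr C \<Longrightarrow> Id C (Cod C f) \<cdot> f = f \<and> f \<cdot> Id C (Dom C f) = f"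
    and "\<And>f g h. f \<in> Arr C \<Longrightarrow> g \<in> Arr C \<Longrightarrow> h \<in> Arr C \<Longrightarrow> Cod C f = Dom C g \<Longrightarrow>
           Cod C g = Dom C h \<Longrightarrow> (h \<cdot> g) \<cdot> f = h \<cdot> (g \<cdot> f)"
  shows "category C"
  by unfold_locales (use assms in \<open>auto simp: Hom_def\<close>)

text \<open>The structure of a category can be carried along a bijection on objects and arrows.  Hence only
  one of two isomorphic categories has to be checked to be a category.\<close>

lemma bijective_image_category:
  assumes "category A"
    and FO: "bij_betw FO (Obj A) (Obj B)" and FA: "bij_betw FA (Arr A) (Arr B)"
    and dc: "\<And>f. f \<in> Arr A \<Longrightarrow> Dom B (FA f) = FO (Dom A f) \<and> Cod B (FA f) = FO (Cod A f)"
    and id: "\<And>x. x \<in> Obj A \<Longrightarrow> FA (Id A x) = Id B (FO x)"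
    and comp: "\<And>f g. f \<in> Arr A \<Longrightarrow> g \<in> Arr A \<Longrightarrow> Cod A f = Dom A g \<Longrightarrow>
          FA (g \<cdot>\<^bsub>A\<^esub> f) = FA g \<cdot>\<^bsub>B\<^esub> FA f"
  shows "category B"
proof -
  interpret category A by fact
  have O: "\<exists>x'\<in>Obj A. x = FO x'" if "x \<in> Obj B" for x
    using FO that by (auto simp: bij_betw_def)
  have A: "\<exists>f'\<in>Arr A. f = FA f'" if "f \<in> Arr B" for f
    using FA that by (auto simp: bij_betw_def)
  have FO_in: "FO x \<in> Obj B" if "x \<in> Obj A" for x
    using FO that by (auto simp: bij_betw_def)
  have FA_in: "FA f \<in> Arr B" if "f \<in> Arr A" for f
    using FA that by (auto simp: bij_betw_def)
  have composable: "Cod A f = Dom A g"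
    if "f \<in> Arr A" "g \<in> Arr A" "Cod B (FA f) = Dom B (FA g)" for f g
    using that FO dc by (auto simp: bij_betw_def dest: inj_onD)
  show ?thesis
  proof (rule categoryI)
    fix f assume "f \<in> Arr B"
    then obtain f' where "f' \<in> Arr A" "f = FA f'" using A by blast
    then show "Dom B f \<in> Obj B \<and> Cod B f \<in> Obj B"
      "Id B (Cod B f) \<cdot>\<^bsub>B\<^esub> f = f \<and> f \<cdot>\<^bsub>B\<^esub> Id B (Dom B f) = f"
      by (simp_all add: dc FO_in flip: id comp)
  next
    fix x assume "x \<in> Obj B"
    then obtain x' where "x' \<in> Obj A" "x = FO x'" using O by blast
    then show "Id B x \<in> Arr B \<and> Dom B (Id B x) = x \<and> Cod B (Id B x) = x"
      by (simp add: dc FA_in flip: id)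
  next
    fix f g assume *: "f \<in> Arr B" "g \<in> Arr B" "Cod B f = Dom B g"
    then obtain f' g' where [simp]: "f' \<in> Arr A" "f = FA f'" "g' \<in> Arr A" "g = FA g'"
      using A by metis
    have [simp]: "Dom A g' = Cod A f'" using * composable[of f' g'] by simp
    show "g \<cdot>\<^bsub>B\<^esub> f \<in> Arr B \<and> Dom B (g \<cdot>\<^bsub>B\<^esub> f) = Dom B f \<and> Cod B (g \<cdot>\<^bsub>B\<^esub> f) = Cod B g"
      by (simp add: dc FA_in flip: comp)
  next
    fix f g h assume *: "f \<in> Arr B" "g \<in> Arr B" "h \<in> Arr B"
      "Cod B f = Dom B g" "Cod B g = Dom B h"
    then obtain f' g' h' where [simp]: "f' \<in> Arr A" "f = FA f'" "g' \<in> Arr A" "g = FA g'"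
        "h' \<in> Arr A" "h = FA h'"
      using A by metis
    have [simp]: "Dom A g' = Cod A f'" "Dom A h' = Cod A g'"
      using * composable[of f' g'] composable[of g' h'] by simp_all
    show "(h \<cdot>\<^bsub>B\<^esub> g) \<cdot>\<^bsub>B\<^esub> f = h \<cdot>\<^bsub>B\<^esub> g \<cdot>\<^bsub>B\<^esub> f"
      by (simp flip: comp)
  qed
qed

lemma isomorphic_categoriesI:
  assumes "category A"
    and FO: "bij_betw FO (Obj A) (Obj B)" and FA: "bij_betw FA (Arr A) (Arr B)"
    and dc: "\<And>f. f \<in> Arr A \<Longrightarrow> Dom B (FA f) = FO (Dom A f) \<and> Cod B (FA f) = FO (Cod A f)"
    and id: "\<And>x. x \<in> Obj A \<Longrightarrow> FA (Id A x) = Id B (FO x)"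
    and comp: "\<And>f g. f \<in> Arr A \<Longrightarrow> g \<in> Arr A \<Longrightarrow> Cod A f = Dom A g \<Longrightarrow>
          FA (g \<cdot>\<^bsub>A\<^esub> f) = FA g \<cdot>\<^bsub>B\<^esub> FA f"
  shows "isomorphic_categories A B"
proof -
  interpret A: category A by fact
  interpret B: category B
    using assms by (rule bijective_image_category)
  let ?GO = "inv_into (Obj A) FO" and ?GA = "inv_into (Arr A) FA"
  note O = bij_betw_inv_into_left[OF FO] bij_betw_inv_into_right[OF FO]
    bij_betw_apply[OF FO] bij_betw_apply[OF bij_betw_inv_into[OF FO]]
  note A = bij_betw_inv_into_left[OF FA] bij_betw_inv_into_right[OF FA]
    bij_betw_apply[OF FA] bij_betw_apply[OF bij_betw_inv_into[OF FA]]
  have G_dc: "Dom A (?GA f) = ?GO (Dom B f) \<and> Cod A (?GA f) = ?GO (Cod B f)" if "f \<in> Arr B" for f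
    using dc[of "?GA f"] that O(1)[of "Dom A (?GA f)"] O(1)[of "Cod A (?GA f)"] by (simp add: A)
  have "is_functor A B \<lparr>FObj = FO, FArr = FA\<rparr>"
    by unfold_locales (auto simp: O A dc id comp Hom_def)
  moreover have "is_functor B A \<lparr>FObj = ?GO, FArr = ?GA\<rparr>"
  proof (unfold_locales, unfold functor_data.simps)
    show "?GO x \<in> Obj A" if "x \<in> Obj B" for x
      using that by (rule O)
    show "?GA f \<in> Hom A (?GO x) (?GO y)" if "f \<in> Hom B x y" for f x y
      using that by (auto simp: A G_dc Hom_def)
    show "?GA (Id B x) = Id A (?GO x)" if "x \<in> Obj B" for x
      using that A(1)[of "Id A (?GO x)"] by (simp add: O id)
    show "?GA (g \<cdot>\<^bsub>B\<^esub> f) = ?GA g \<cdot>\<^bsub>A\<^esub> ?GA f" if "f \<in> Hom B x y" "g \<in> Hom B y z" for f g x y z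
      using that A(1)[of "?GA g \<cdot>\<^bsub>A\<^esub> ?GA f"] by (simp add: A G_dc comp Hom_def)
  qed
  ultimately show ?thesis
    unfolding isomorphic_categories_def
    by (intro exI[of _ "\<lparr>FObj = FO, FArr = FA\<rparr>"] exI[of _ "\<lparr>FObj = ?GO, FArr = ?GA\<rparr>"]) (simp add: O A)
qed

text \<open>The equation \<open>\<gamma>' \<cdot> h = \<gamma>\<close> between the components of an arrow must only be used from left to
  right: eliminating \<open>\<gamma>\<close> by substitution would make \<open>Dom C h = Dom C \<gamma>\<close> a looping rewrite rule.\<close>

lemma (in category) slice_category:
  "category (slice C b)"
proof (rule categoryI)
  fix f g assume fg: "f \<in> Arr (slice C b)" "g \<in> Arr (slice C b)" "Cod (slice C b) f = Dom (slice C b) g"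
  obtain \<gamma>1 \<gamma>2 \<gamma>3 h k where f: "f = (\<gamma>1, \<gamma>2, h)" and g: "g = (\<gamma>2, \<gamma>3, k)"
    using fg(3) by (cases f; cases g) (auto simp: slice_def)
  have "\<gamma>3 \<cdot> k \<cdot> h = (\<gamma>3 \<cdot> k) \<cdot> h"
    by (rule comp_assoc[symmetric]) (use fg in \<open>simp_all add: slice_def Hom_def f g\<close>)
  also have "\<dots> = \<gamma>1"
    using fg by (simp add: slice_def Hom_def f g)
  finally show "g \<cdot>\<^bsub>slice C b\<^esub> f \<in> Arr (slice C b) \<and>
      Dom (slice C b) (g \<cdot>\<^bsub>slice C b\<^esub> f) = Dom (slice C b) f \<and>
      Cod (slice C b) (g \<cdot>\<^bsub>slice C b\<^esub> f) = Cod (slice C b) g"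
    using fg by (simp add: slice_def Hom_def f g)
qed (simp_all add: slice_def Hom_def split_beta prod_eq_iff)

lemma algebra_category:
  assumes "monad B T \<eta> \<mu>"
  shows "category (Alg B T \<eta> \<mu>)"
proof -
  interpret monad B T \<eta> \<mu> by fact
  show ?thesis
  proof (rule categoryI)
    fix A assume "A \<in> Obj (Alg B T \<eta> \<mu>)"
    then show "Id (Alg B T \<eta> \<mu>) A \<in> Arr (Alg B T \<eta> \<mu>) \<and> Dom (Alg B T \<eta> \<mu>) (Id (Alg B T \<eta> \<mu>) A) = A
        \<and> Cod (Alg B T \<eta> \<mu>) (Id (Alg B T \<eta> \<mu>) A) = A"
      by (auto simp: Alg_def is_algebra_def Hom_def endo.FArr_Id)
  next
    fix f g assume fg: "f \<in> Arr (Alg B T \<eta> \<mu>)" "g \<in> Arr (Alg B T \<eta> \<mu>)"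
      "Cod (Alg B T \<eta> \<mu>) f = Dom (Alg B T \<eta> \<mu>) g"
    then obtain x a y b h z d k where
      f: "f = ((x, a), (y, b), h)" and g: "g = ((y, b), (z, d), k)"
      and alg: "is_algebra B T \<eta> \<mu> (x, a)" "is_algebra B T \<eta> \<mu> (y, b)" "is_algebra B T \<eta> \<mu> (z, d)"
      and h: "h \<in> Hom B x y" "h \<cdot>\<^bsub>B\<^esub> a = b \<cdot>\<^bsub>B\<^esub> FArr T h"
      and k: "k \<in> Hom B y z" "k \<cdot>\<^bsub>B\<^esub> b = d \<cdot>\<^bsub>B\<^esub> FArr T k"
      by (auto simp: Alg_def)
    have a: "a \<in> Hom B (FObj T x) x" "b \<in> Hom B (FObj T y) y" "d \<in> Hom B (FObj T z) z"
      using alg by (auto simp: is_algebra_def)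
    note Th = endo.FArr_in[OF h(1)] and Tk = endo.FArr_in[OF k(1)]
    have "(k \<cdot>\<^bsub>B\<^esub> h) \<cdot>\<^bsub>B\<^esub> a = k \<cdot>\<^bsub>B\<^esub> b \<cdot>\<^bsub>B\<^esub> FArr T h"
      using h k a by (simp add: Hom_def)
    also have "\<dots> = (k \<cdot>\<^bsub>B\<^esub> b) \<cdot>\<^bsub>B\<^esub> FArr T h"
      using k(1) a Th by (simp add: Hom_def)
    also have "\<dots> = d \<cdot>\<^bsub>B\<^esub> FArr T (k \<cdot>\<^bsub>B\<^esub> h)"
      unfolding k(2) using k(1) a Th Tk endo.FArr_Comp[OF h(1) k(1)] by (simp add: Hom_def)
    finally show "g \<cdot>\<^bsub>Alg B T \<eta> \<mu>\<^esub> f \<in> Arr (Alg B T \<eta> \<mu>) \<and>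
        Dom (Alg B T \<eta> \<mu>) (g \<cdot>\<^bsub>Alg B T \<eta> \<mu>\<^esub> f) = Dom (Alg B T \<eta> \<mu>) f \<and>
        Cod (Alg B T \<eta> \<mu>) (g \<cdot>\<^bsub>Alg B T \<eta> \<mu>\<^esub> f) = Cod (Alg B T \<eta> \<mu>) g"
      using f g alg h(1) k(1) by (auto simp: Alg_def Hom_def)
  qed (auto simp: Alg_def Hom_def)
qed


section \<open>Elements of pullbacks\<close>

locale category_with_pullbacks = category C for C :: "('o, 'a) cat" (structure) +
  fixes PB :: "'a pb_choice"
  assumes pullbacks: "pullback_choice C PB"
begin

lemma pb_is_pullback:
  "f \<in> Arr C \<Longrightarrow> g \<in> Arr C \<Longrightarrow> Cod C f = Cod C g \<Longrightarrow> is_pullback C f g (proj1 PB f g) (proj2 PB f g)"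
  using pullbacks by (auto simp: pullback_choice_def)

lemma proj_simps [simp]:
  assumes "f \<in> Arr C" "g \<in> Arr C" "Cod C f = Cod C g"
  shows "proj1 PB f g \<in> Arr C" "Cod C (proj1 PB f g) = Dom C f"
    "proj2 PB f g \<in> Arr C" "Dom C (proj2 PB f g) = Dom C (proj1 PB f g)"
    "Cod C (proj2 PB f g) = Dom C g" "f \<cdot> proj1 PB f g = g \<cdot> proj2 PB f g"
  using pb_is_pullback[OF assms] by (auto simp: is_pullback_def Hom_def)

lemma proj_commute [simp]:
  assumes "f \<in> Arr C" "g \<in> Arr C" "Cod C f = Cod C g"
    and "w \<in> Arr C" "Cod C w = Dom C (proj1 PB f g)"
  shows "f \<cdot> proj1 PB f g \<cdot> w = g \<cdot> proj2 PB f g \<cdot> w"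
  using assms comp_assoc[of w "proj1 PB f g" f] by simp

lemma pb_universal:
  assumes "f \<in> Arr C" "g \<in> Arr C" "Cod C f = Cod C g"
    and "u \<in> Arr C" "v \<in> Arr C" "Dom C u = Dom C v" "Cod C u = Dom C f" "Cod C v = Dom C g"
    and "f \<cdot> u = g \<cdot> v"
  shows "\<exists>!w. w \<in> Hom C (Dom C u) (Dom C (proj1 PB f g)) \<and> proj1 PB f g \<cdot> w = u \<and> proj2 PB f g \<cdot> w = v"
proof -
  have "u \<in> Hom C (Dom C u) (Dom C f)" "v \<in> Hom C (Dom C u) (Dom C g)"
    using assms by (simp_all add: Hom_def)
  then show ?thesis
    using pb_is_pullback[OF assms(1-3)] assms(9) unfolding is_pullback_def by blast
qed

text \<open>The hypotheses on \<open>u\<close> and \<open>v\<close> here and in \<open>pair_comp\<close> say that \<open>(u, v)\<close> is an element of the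
  pullback of \<open>(f, g)\<close>.\<close>

lemma pair_simps [simp]:
  assumes "f \<in> Arr C" "g \<in> Arr C" "Cod C f = Cod C g"
    and "u \<in> Arr C" "v \<in> Arr C" "Dom C u = Dom C v" "Cod C u = Dom C f" "Cod C v = Dom C g"
    and "f \<cdot> u = g \<cdot> v"
  shows "pb_pair C PB f g u v \<in> Arr C" "Dom C (pb_pair C PB f g u v) = Dom C v"
    "Cod C (pb_pair C PB f g u v) = Dom C (proj1 PB f g)"
    "proj1 PB f g \<cdot> pb_pair C PB f g u v = u" "proj2 PB f g \<cdot> pb_pair C PB f g u v = v"
proof -
  let ?w = "pb_pair C PB f g u v"
  have "?w \<in> Hom C (Dom C u) (Dom C (proj1 PB f g)) \<and> proj1 PB f g \<cdot> ?w = u \<and> proj2 PB f g \<cdot> ?w = v"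
    unfolding pb_pair_def by (rule theI') (rule pb_universal[OF assms])
  then show "?w \<in> Arr C" "Dom C ?w = Dom C v" "Cod C ?w = Dom C (proj1 PB f g)"
    "proj1 PB f g \<cdot> ?w = u" "proj2 PB f g \<cdot> ?w = v"
    by (simp_all add: Hom_def assms(6))
qed

lemma pair_proj [simp]:
  assumes "f \<in> Arr C" "g \<in> Arr C" "Cod C f = Cod C g"
    and "w \<in> Arr C" "Cod C w = Dom C (proj1 PB f g)"
  shows "pb_pair C PB f g (proj1 PB f g \<cdot> w) (proj2 PB f g \<cdot> w) = w"
proof -
  let ?u = "proj1 PB f g \<cdot> w" and ?v = "proj2 PB f g \<cdot> w"
  have "\<exists>!w'. w' \<in> Hom C (Dom C ?u) (Dom C (proj1 PB f g)) \<and>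
          proj1 PB f g \<cdot> w' = ?u \<and> proj2 PB f g \<cdot> w' = ?v"
    by (rule pb_universal) (use assms in simp_all)
  then show ?thesis
    unfolding pb_pair_def by (rule the1_equality) (use assms in \<open>simp add: Hom_def\<close>)
qed

lemma pair_proj_id [simp]:
  assumes "f \<in> Arr C" "g \<in> Arr C" "Cod C f = Cod C g"
  shows "pb_pair C PB f g (proj1 PB f g) (proj2 PB f g) = Id C (Dom C (proj1 PB f g))"
  using pair_proj[OF assms, of "Id C (Dom C (proj1 PB f g))"] assms by simp

text \<open>The change of stage of an element, computed componentwise.  Together with \<open>pair_simps\<close> and
  \<open>pair_proj\<close> this brings composites of pairs and projections into a normal form.\<close>

lemma pair_comp [simp]:
  assumes "f \<in> Arr C" "g \<in> Arr C" "Cod C f = Cod C g"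
    and "u \<in> Arr C" "v \<in> Arr C" "Dom C u = Dom C v" "Cod C u = Dom C f" "Cod C v = Dom C g"
    and "f \<cdot> u = g \<cdot> v"
    and "w \<in> Arr C" "Cod C w = Dom C v"
  shows "pb_pair C PB f g u v \<cdot> w = pb_pair C PB f g (u \<cdot> w) (v \<cdot> w)"
proof -
  have "proj1 PB f g \<cdot> pb_pair C PB f g u v \<cdot> w = u \<cdot> w"
    "proj2 PB f g \<cdot> pb_pair C PB f g u v \<cdot> w = v \<cdot> w"
    using assms by (simp_all del: comp_assoc add: comp_assoc[symmetric])
  then show ?thesis
    using pair_proj[OF assms(1-3), of "pb_pair C PB f g u v \<cdot> w"] assms by simp
qed

end


section \<open>Internal composition of elements\<close>

locale internal_category_in = category_with_pullbacks C PB
  for C :: "('o, 'a) cat" (structure) and PB :: "'a pb_choice" +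
  fixes D :: "('o, 'a) internal_cat"
  assumes internal: "internal_category C PB D"
begin

text \<open>With \<open>\<gamma> = t\<close>, the pairs \<open>\<langle>g, x\<rangle>\<^bsub>\<gamma>\<^esub>\<close> are the composable pairs of \<open>D\<close>, so one notation
  serves for both the composition of \<open>D\<close> and its actions.\<close>

abbreviation "s \<equiv> src D"
abbreviation "t \<equiv> tgt D"
abbreviation "\<iota> \<equiv> ident D"
abbreviation "\<pi>1 \<equiv> proj1 PB s"
abbreviation "\<pi>2 \<equiv> proj2 PB s"
abbreviation pair ("\<langle>_, _\<rangle>\<^bsub>_\<^esub>") where "\<langle>g, x\<rangle>\<^bsub>\<gamma>\<^esub> \<equiv> pb_pair C PB s \<gamma> g x"
abbreviation "T \<gamma> \<equiv> t \<cdot> \<pi>1 \<gamma>"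

definition icomp (infixr "\<star>" 75) where "g \<star> f = cmp D \<cdot> \<langle>g, f\<rangle>\<^bsub>t\<^esub>"

lemma D_simps [simp]:
  "D0 D \<in> Obj C" "D1 D \<in> Obj C"
  "s \<in> Arr C" "Dom C s = D1 D" "Cod C s = D0 D"
  "t \<in> Arr C" "Dom C t = D1 D" "Cod C t = D0 D"
  "\<iota> \<in> Arr C" "Dom C \<iota> = D0 D" "Cod C \<iota> = D1 D"
  "cmp D \<in> Arr C" "Dom C (cmp D) = Dom C (\<pi>1 t)" "Cod C (cmp D) = D1 D"
  "s \<cdot> \<iota> = Id C (D0 D)" "t \<cdot> \<iota> = Id C (D0 D)"
  "s \<cdot> cmp D = s \<cdot> \<pi>2 t" "t \<cdot> cmp D = t \<cdot> \<pi>1 t"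
  using internal by (simp_all add: internal_category_def Let_def Hom_def)

text \<open>A commuting triangle in the form in which it meets a right-nested composite.\<close>

lemma triangle:
  assumes "g \<cdot> f = h" "f \<in> Arr C" "g \<in> Arr C" "Dom C g = Cod C f" "w \<in> Arr C" "Dom C f = Cod C w"
  shows "g \<cdot> f \<cdot> w = h \<cdot> w"
  using assms comp_assoc[of w f g] by metis

lemma ident_comp [simp]:
  assumes "w \<in> Arr C" "Cod C w = D0 D"
  shows "s \<cdot> \<iota> \<cdot> w = w" "t \<cdot> \<iota> \<cdot> w = w"
  using assms triangle[of s \<iota> "Id C (D0 D)" w] triangle[of t \<iota> "Id C (D0 D)" w] by simp_all

lemma icomp_simps [simp]:
  assumes "g \<in> Arr C" "f \<in> Arr C" "Cod C g = D1 D" "Cod C f = D1 D" "Dom C g = Dom C f"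
    and "s \<cdot> g = t \<cdot> f"
  shows "g \<star> f \<in> Arr C" "Dom C (g \<star> f) = Dom C f" "Cod C (g \<star> f) = D1 D"
    "s \<cdot> (g \<star> f) = s \<cdot> f" "t \<cdot> (g \<star> f) = t \<cdot> g"
  using assms triangle[of s "cmp D" "s \<cdot> \<pi>2 t" "\<langle>g, f\<rangle>\<^bsub>t\<^esub>"]
    triangle[of t "cmp D" "t \<cdot> \<pi>1 t" "\<langle>g, f\<rangle>\<^bsub>t\<^esub>"]
  by (simp_all add: icomp_def)

lemma icomp_comp [simp]:
  assumes "g \<in> Arr C" "f \<in> Arr C" "Cod C g = D1 D" "Cod C f = D1 D" "Dom C g = Dom C f"
    and "s \<cdot> g = t \<cdot> f" and "w \<in> Arr C" "Cod C w = Dom C f"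
  shows "(g \<star> f) \<cdot> w = (g \<cdot> w) \<star> (f \<cdot> w)"
proof -
  have "s \<cdot> g \<cdot> w = t \<cdot> f \<cdot> w"
    using assms triangle[of s g "t \<cdot> f" w] by simp
  then show ?thesis using assms by (simp add: icomp_def)
qed

lemma icomp_ident [simp]:
  assumes "f \<in> Arr C" "Cod C f = D1 D"
  shows "(\<iota> \<cdot> t \<cdot> f) \<star> f = f" "f \<star> (\<iota> \<cdot> s \<cdot> f) = f"
proof -
  have "(\<iota> \<cdot> t) \<star> Id C (D1 D) = Id C (D1 D)" "Id C (D1 D) \<star> (\<iota> \<cdot> s) = Id C (D1 D)"
    using internal by (simp_all add: internal_category_def Let_def icomp_def)
  then have "((\<iota> \<cdot> t) \<star> Id C (D1 D)) \<cdot> f = f" "(Id C (D1 D) \<star> (\<iota> \<cdot> s)) \<cdot> f = f"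
    using assms by simp_all
  then show "(\<iota> \<cdot> t \<cdot> f) \<star> f = f" "f \<star> (\<iota> \<cdot> s \<cdot> f) = f"
    using assms by simp_all
qed

text \<open>The law \<open>\<xi>(h \<star> g, x) = \<xi>(h, \<xi>(g, x))\<close> for elements \<open>h\<close>, \<open>g\<close>, \<open>x\<close> at an arbitrary common
  stage.\<close>

definition acts_associatively :: "'a \<Rightarrow> 'a \<Rightarrow> bool" where
  "acts_associatively \<gamma> \<xi> \<longleftrightarrow>
     (\<forall>h g x. h \<in> Arr C \<and> g \<in> Arr C \<and> x \<in> Arr C \<and> Cod C h = D1 D \<and> Cod C g = D1 D \<and>
        Cod C x = Dom C \<gamma> \<and> Dom C h = Dom C x \<and> Dom C g = Dom C x \<and>
        s \<cdot> h = t \<cdot> g \<and> s \<cdot> g = \<gamma> \<cdot> x \<longrightarrow>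
        \<xi> \<cdot> \<langle>h \<star> g, x\<rangle>\<^bsub>\<gamma>\<^esub> = \<xi> \<cdot> \<langle>h, \<xi> \<cdot> \<langle>g, x\<rangle>\<^bsub>\<gamma>\<^esub>\<rangle>\<^bsub>\<gamma>\<^esub>)"

lemma acts_associativelyD:
  assumes "acts_associatively \<gamma> \<xi>"
    and "h \<in> Arr C" "g \<in> Arr C" "x \<in> Arr C" "Cod C h = D1 D" "Cod C g = D1 D"
    and "Cod C x = Dom C \<gamma>" "Dom C h = Dom C x" "Dom C g = Dom C x" "s \<cdot> h = t \<cdot> g" "s \<cdot> g = \<gamma> \<cdot> x"
  shows "\<xi> \<cdot> \<langle>h \<star> g, x\<rangle>\<^bsub>\<gamma>\<^esub> = \<xi> \<cdot> \<langle>h, \<xi> \<cdot> \<langle>g, x\<rangle>\<^bsub>\<gamma>\<^esub>\<rangle>\<^bsub>\<gamma>\<^esub>"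
  using assms unfolding acts_associatively_def by blast

text \<open>The arrows compared by \<open>assoc_law\<close> start at the iterated pullback, whose elements are the
  triples \<open>((h, g), x)\<close>.  Its identity is the generic triple, at which the elementwise law becomes
  \<open>assoc_law\<close>; conversely, every triple arises from the generic one by a change of stage.\<close>

lemma assoc_law_iff:
  assumes \<gamma>: "\<gamma> \<in> Arr C" "Cod C \<gamma> = D0 D"
    and \<xi>: "\<xi> \<in> Arr C" "Dom C \<xi> = Dom C (\<pi>1 \<gamma>)" "Cod C \<xi> = Dom C \<gamma>" "\<gamma> \<cdot> \<xi> = T \<gamma>"
  shows "assoc_law C PB D \<gamma> \<xi> \<longleftrightarrow> acts_associatively \<gamma> \<xi>"
proof -
  let ?l = "s \<cdot> \<pi>2 t"
  \<comment> \<open>The generic triple is \<open>((\<pi>1 t \<cdot> p, \<pi>2 t \<cdot> p), q)\<close>.\<close>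
  define p where "p = proj1 PB ?l \<gamma>"
  define q where "q = proj2 PB ?l \<gamma>"
  have p [simp]: "p \<in> Arr C" "Cod C p = Dom C (\<pi>1 t)" and q [simp]: "q \<in> Arr C"
    "Dom C q = Dom C p" "Cod C q = Dom C \<gamma>"
    using \<gamma> by (simp_all add: p_def q_def)
  have pq [simp]: "s \<cdot> \<pi>2 t \<cdot> p = \<gamma> \<cdot> q"
  proof -
    have "s \<cdot> \<pi>2 t \<cdot> p = ?l \<cdot> p"
      by (rule comp_assoc[symmetric]) simp_all
    also have "\<dots> = \<gamma> \<cdot> q"
      unfolding p_def q_def by (rule proj_simps) (use \<gamma> in simp_all)
    finally show ?thesis .
  qed
  have \<xi>_over: "\<gamma> \<cdot> \<xi> \<cdot> w = t \<cdot> \<pi>1 \<gamma> \<cdot> w" if "w \<in> Arr C" "Cod C w = Dom C (\<pi>1 \<gamma>)" for w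
    using triangle[OF \<xi>(4), of w] that \<gamma> \<xi> by simp
  have cmp: "cmp D \<cdot> p = (\<pi>1 t \<cdot> p) \<star> (\<pi>2 t \<cdot> p)"
    by (simp add: icomp_def)
  have src_cmp: "s \<cdot> cmp D \<cdot> p = \<gamma> \<cdot> q"
    using triangle[of s "cmp D" "s \<cdot> \<pi>2 t" p] by simp
  have law: "assoc_law C PB D \<gamma> \<xi> \<longleftrightarrow>
      \<xi> \<cdot> \<langle>(\<pi>1 t \<cdot> p) \<star> (\<pi>2 t \<cdot> p), q\<rangle>\<^bsub>\<gamma>\<^esub> = \<xi> \<cdot> \<langle>\<pi>1 t \<cdot> p, \<xi> \<cdot> \<langle>\<pi>2 t \<cdot> p, q\<rangle>\<^bsub>\<gamma>\<^esub>\<rangle>\<^bsub>\<gamma>\<^esub>"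
    using \<gamma> \<xi> by (simp add: assoc_law_def assoc_iso_def pb_map_def Let_def \<xi>_over cmp
        flip: p_def q_def)
  show ?thesis
  proof
    assume "acts_associatively \<gamma> \<xi>"
    then show "assoc_law C PB D \<gamma> \<xi>"
      unfolding law by (rule acts_associativelyD) simp_all
  next
    assume generic: "assoc_law C PB D \<gamma> \<xi>"
    show "acts_associatively \<gamma> \<xi>"
      unfolding acts_associatively_def
    proof (intro allI impI, elim conjE)
      fix h g x
      assume [simp]: "h \<in> Arr C" "g \<in> Arr C" "x \<in> Arr C" "Cod C h = D1 D" "Cod C g = D1 D"
        "Cod C x = Dom C \<gamma>" "Dom C h = Dom C x" "Dom C g = Dom C x" "s \<cdot> h = t \<cdot> g" "s \<cdot> g = \<gamma> \<cdot> x"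
      define w where "w = pb_pair C PB ?l \<gamma> \<langle>h, g\<rangle>\<^bsub>t\<^esub> x"
      have w [simp]: "w \<in> Arr C" "Cod C w = Dom C p" "Dom C w = Dom C x"
        "p \<cdot> w = \<langle>h, g\<rangle>\<^bsub>t\<^esub>" "q \<cdot> w = x"
        using \<gamma> by (simp_all add: w_def p_def q_def)
      from generic have "(\<xi> \<cdot> \<langle>(\<pi>1 t \<cdot> p) \<star> (\<pi>2 t \<cdot> p), q\<rangle>\<^bsub>\<gamma>\<^esub>) \<cdot> w =
          (\<xi> \<cdot> \<langle>\<pi>1 t \<cdot> p, \<xi> \<cdot> \<langle>\<pi>2 t \<cdot> p, q\<rangle>\<^bsub>\<gamma>\<^esub>\<rangle>\<^bsub>\<gamma>\<^esub>) \<cdot> w"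
        by (simp only: law)
      then show "\<xi> \<cdot> \<langle>h \<star> g, x\<rangle>\<^bsub>\<gamma>\<^esub> = \<xi> \<cdot> \<langle>h, \<xi> \<cdot> \<langle>g, x\<rangle>\<^bsub>\<gamma>\<^esub>\<rangle>\<^bsub>\<gamma>\<^esub>"
        using \<gamma> \<xi> by (simp add: \<xi>_over)
    qed
  qed
qed

text \<open>The composition of \<open>D\<close> is the action of \<open>D\<close> on \<open>D1\<close> over \<open>t\<close>.\<close>

lemma icomp_assoc [simp]:
  assumes "h \<in> Arr C" "g \<in> Arr C" "f \<in> Arr C" "Cod C h = D1 D" "Cod C g = D1 D" "Cod C f = D1 D"
    and "Dom C h = Dom C g" "Dom C g = Dom C f" "s \<cdot> h = t \<cdot> g" "s \<cdot> g = t \<cdot> f"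
  shows "(h \<star> g) \<star> f = h \<star> (g \<star> f)"
proof -
  have "acts_associatively t (cmp D)"
    using internal assoc_law_iff[of t "cmp D"] by (simp add: internal_category_def Let_def)
  then show ?thesis
    using acts_associativelyD[of t "cmp D" h g f] assms by (simp add: icomp_def)
qed

end


section \<open>The monad\<close>

context category
begin

lemma slice_simps [simp]:
  "\<gamma> \<in> Obj (slice C b) \<longleftrightarrow> \<gamma> \<in> Arr C \<and> Cod C \<gamma> = b"
  "Id (slice C b) \<gamma> = (\<gamma>, \<gamma>, Id C (Dom C \<gamma>))"
  "(\<beta>, \<beta>', k) \<cdot>\<^bsub>slice C b\<^esub> (\<gamma>, \<gamma>', h) = (\<gamma>, \<beta>', k \<cdot> h)"
  "(\<beta>, \<beta>', h) \<in> Hom (slice C b) \<gamma> \<gamma>' \<longleftrightarrow> \<beta> = \<gamma> \<and> \<beta>' = \<gamma>' \<and>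
     \<gamma> \<in> Arr C \<and> Cod C \<gamma> = b \<and> \<gamma>' \<in> Arr C \<and> Cod C \<gamma>' = b \<and>
     h \<in> Arr C \<and> Dom C h = Dom C \<gamma> \<and> Cod C h = Dom C \<gamma>' \<and> \<gamma>' \<cdot> h = \<gamma>"
  by (simp_all add: slice_def Hom_def conj_ac cong: conj_cong)

lemma slice_HomE:
  assumes "f \<in> Hom (slice C b) \<gamma> \<gamma>'"
  obtains h where "f = (\<gamma>, \<gamma>', h)" "\<gamma> \<in> Arr C" "Cod C \<gamma> = b" "\<gamma>' \<in> Arr C" "Cod C \<gamma>' = b"
    "h \<in> Arr C" "Dom C h = Dom C \<gamma>" "Cod C h = Dom C \<gamma>'" "\<gamma>' \<cdot> h = \<gamma>"
  using assms by (cases f) simp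

end

lemma id_functor_is_functor: "category A \<Longrightarrow> is_functor A A id_functor"
  by (simp add: is_functor_def is_functor_axioms_def id_functor_def)

lemma comp_functor_is_functor:
  assumes "is_functor A B F" "is_functor B E G"
  shows "is_functor A E (comp_functor G F)"
proof -
  interpret F: is_functor A B F by fact
  interpret G: is_functor B E G by fact
  show ?thesis
    by unfold_locales
      (auto simp: comp_functor_def F.FObj_in G.FObj_in F.FArr_Id G.FArr_Id F.FArr_Comp
        intro: F.FArr_in G.FArr_in G.FArr_Comp[OF F.FArr_in F.FArr_in])
qed

context internal_category_in
begin

abbreviation "\<B> \<equiv> slice C (D0 D)"
abbreviation "\<T> \<equiv> T_functor C PB D"

text \<open>On elements: \<open>x \<mapsto> (1, x)\<close>.\<close>

definition unit :: "'a \<Rightarrow> 'a \<times> 'a \<times> 'a" where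
  "unit \<gamma> = (\<gamma>, T \<gamma>, \<langle>\<iota> \<cdot> \<gamma>, Id C (Dom C \<gamma>)\<rangle>\<^bsub>\<gamma>\<^esub>)"

text \<open>On elements: \<open>(h, (g, x)) \<mapsto> (h \<star> g, x)\<close>.\<close>

definition mult :: "'a \<Rightarrow> 'a \<times> 'a \<times> 'a" where
  "mult \<gamma> = (T (T \<gamma>), T \<gamma>, \<langle>\<pi>1 (T \<gamma>) \<star> (\<pi>1 \<gamma> \<cdot> \<pi>2 (T \<gamma>)), \<pi>2 \<gamma> \<cdot> \<pi>2 (T \<gamma>)\<rangle>\<^bsub>\<gamma>\<^esub>)"

lemma T_functor_FObj [simp]: "FObj \<T> \<gamma> = T \<gamma>"
  by (simp add: T_functor_def Let_def)

lemma T_functor_FArr [simp]: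
  assumes "\<gamma> \<in> Arr C" "Cod C \<gamma> = D0 D"
  shows "FArr \<T> (\<gamma>, \<gamma>', f) = (T \<gamma>, T \<gamma>', \<langle>\<pi>1 \<gamma>, f \<cdot> \<pi>2 \<gamma>\<rangle>\<^bsub>\<gamma>'\<^esub>)"
  using assms by (simp add: T_functor_def Let_def pb_map_def)

lemma T_is_functor: "is_functor \<B> \<B> \<T>"
proof -
  interpret \<B>: category \<B> by (rule slice_category)
  show ?thesis
  proof
    show "FObj \<T> \<gamma> \<in> Obj \<B>" if "\<gamma> \<in> Obj \<B>" for \<gamma>
      using that by simp
    show "FArr \<T> (Id \<B> \<gamma>) = Id \<B> (FObj \<T> \<gamma>)" if "\<gamma> \<in> Obj \<B>" for \<gamma>
      using that by simp
    show "FArr \<T> f \<in> Hom \<B> (FObj \<T> \<gamma>) (FObj \<T> \<gamma>')" if "f \<in> Hom \<B> \<gamma> \<gamma>'" for f \<gamma> \<gamma>'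
      using that
    proof (rule slice_HomE)
      fix h assume [simp]: "f = (\<gamma>, \<gamma>', h)" "\<gamma> \<in> Arr C" "Cod C \<gamma> = D0 D" "\<gamma>' \<in> Arr C"
        "Cod C \<gamma>' = D0 D" "h \<in> Arr C" "Dom C h = Dom C \<gamma>" "Cod C h = Dom C \<gamma>'" "\<gamma>' \<cdot> h = \<gamma>"
      show ?thesis by (simp add: triangle[of \<gamma>' h \<gamma>])
    qed
    show "FArr \<T> (g \<cdot>\<^bsub>\<B>\<^esub> f) = FArr \<T> g \<cdot>\<^bsub>\<B>\<^esub> FArr \<T> f"
      if f: "f \<in> Hom \<B> \<gamma> \<gamma>'" and g: "g \<in> Hom \<B> \<gamma>' \<gamma>''" for f g \<gamma> \<gamma>' \<gamma>''
    proof -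
      obtain h where [simp]: "f = (\<gamma>, \<gamma>', h)" "\<gamma> \<in> Arr C" "Cod C \<gamma> = D0 D" "\<gamma>' \<in> Arr C"
        "Cod C \<gamma>' = D0 D" "h \<in> Arr C" "Dom C h = Dom C \<gamma>" "Cod C h = Dom C \<gamma>'" "\<gamma>' \<cdot> h = \<gamma>"
        using f by (rule slice_HomE)
      obtain k where [simp]: "g = (\<gamma>', \<gamma>'', k)" "\<gamma>'' \<in> Arr C"
        "Cod C \<gamma>'' = D0 D" "k \<in> Arr C" "Dom C k = Dom C \<gamma>'" "Cod C k = Dom C \<gamma>''" "\<gamma>'' \<cdot> k = \<gamma>'"
        using g by (rule slice_HomE)
      show ?thesis by (simp add: triangle[of \<gamma>' h \<gamma>] triangle[of \<gamma>'' k \<gamma>'])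
    qed
  qed
qed

lemma unit_natural: "nat_transformation \<B> \<B> id_functor \<T> unit"
proof (intro nat_transformation.intro nat_transformation_axioms.intro
    id_functor_is_functor T_is_functor slice_category)
  fix \<gamma> assume "\<gamma> \<in> Obj \<B>"
  then show "unit \<gamma> \<in> Hom \<B> (FObj id_functor \<gamma>) (FObj \<T> \<gamma>)"
    by (simp add: unit_def id_functor_def)
next
  fix f \<gamma> \<gamma>' assume "f \<in> Hom \<B> \<gamma> \<gamma>'"
  then obtain h where [simp]: "f = (\<gamma>, \<gamma>', h)" "\<gamma> \<in> Arr C" "Cod C \<gamma> = D0 D" "\<gamma>' \<in> Arr C"
    "Cod C \<gamma>' = D0 D" "h \<in> Arr C" "Dom C h = Dom C \<gamma>" "Cod C h = Dom C \<gamma>'" "\<gamma>' \<cdot> h = \<gamma>"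
    by (rule slice_HomE)
  show "unit \<gamma>' \<cdot>\<^bsub>\<B>\<^esub> FArr id_functor f = FArr \<T> f \<cdot>\<^bsub>\<B>\<^esub> unit \<gamma>"
    by (simp add: unit_def id_functor_def triangle[of \<gamma>' h \<gamma>])
qed

lemma mult_natural: "nat_transformation \<B> \<B> (comp_functor \<T> \<T>) \<T> mult"
proof (intro nat_transformation.intro nat_transformation_axioms.intro
    comp_functor_is_functor[OF T_is_functor T_is_functor] T_is_functor)
  fix \<gamma> assume "\<gamma> \<in> Obj \<B>"
  then show "mult \<gamma> \<in> Hom \<B> (FObj (comp_functor \<T> \<T>) \<gamma>) (FObj \<T> \<gamma>)"
    by (simp add: mult_def comp_functor_def)
next
  fix f \<gamma> \<gamma>' assume "f \<in> Hom \<B> \<gamma> \<gamma>'"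
  then obtain h where [simp]: "f = (\<gamma>, \<gamma>', h)" "\<gamma> \<in> Arr C" "Cod C \<gamma> = D0 D" "\<gamma>' \<in> Arr C"
    "Cod C \<gamma>' = D0 D" "h \<in> Arr C" "Dom C h = Dom C \<gamma>" "Cod C h = Dom C \<gamma>'" "\<gamma>' \<cdot> h = \<gamma>"
    by (rule slice_HomE)
  show "mult \<gamma>' \<cdot>\<^bsub>\<B>\<^esub> FArr (comp_functor \<T> \<T>) f = FArr \<T> f \<cdot>\<^bsub>\<B>\<^esub> mult \<gamma>"
    by (simp add: mult_def comp_functor_def triangle[of \<gamma>' h \<gamma>])
qed

text \<open>Evaluated on elements, the three monad laws are \<open>(1 \<star> g, x) = (g, x)\<close>, \<open>(g \<star> 1, x) = (g, x)\<close>
  and \<open>((h \<star> g) \<star> f, x) = (h \<star> (g \<star> f), x)\<close>: they are the category laws of \<open>D\<close>.\<close>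

lemma T_monad: "monad \<B> \<T> unit mult"
proof (intro monad.intro monad_axioms.intro T_is_functor unit_natural mult_natural)
  fix \<gamma> assume "\<gamma> \<in> Obj \<B>"
  then have [simp]: "\<gamma> \<in> Arr C" "Cod C \<gamma> = D0 D" by simp_all
  show "mult \<gamma> \<cdot>\<^bsub>\<B>\<^esub> unit (FObj \<T> \<gamma>) = Id \<B> (FObj \<T> \<gamma>)"
    by (simp add: mult_def unit_def)
  have "\<pi>1 \<gamma> \<star> (\<iota> \<cdot> \<gamma> \<cdot> \<pi>2 \<gamma>) = \<pi>1 \<gamma>"
    using icomp_ident(2)[of "\<pi>1 \<gamma>"] by simp
  then show "mult \<gamma> \<cdot>\<^bsub>\<B>\<^esub> FArr \<T> (unit \<gamma>) = Id \<B> (FObj \<T> \<gamma>)"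
    by (simp add: mult_def unit_def)
  \<comment> \<open>The generic element of \<open>T (T (T \<gamma>))\<close> is \<open>(?k, (?h \<cdot> ?p, (?g \<cdot> ?p, ?x \<cdot> ?p)))\<close>.\<close>
  let ?h = "\<pi>1 (T \<gamma>)" and ?g = "\<pi>1 \<gamma> \<cdot> \<pi>2 (T \<gamma>)" and ?x = "\<pi>2 \<gamma> \<cdot> \<pi>2 (T \<gamma>)"
  have mult_pair: "\<langle>?h \<star> ?g, ?x\<rangle>\<^bsub>\<gamma>\<^esub> \<cdot> \<langle>k, y\<rangle>\<^bsub>T \<gamma>\<^esub> = \<langle>k \<star> (\<pi>1 \<gamma> \<cdot> y), \<pi>2 \<gamma> \<cdot> y\<rangle>\<^bsub>\<gamma>\<^esub>"
    if "k \<in> Arr C" "y \<in> Arr C" "Dom C k = Dom C y" "Cod C k = D1 D" "Cod C y = Dom C (\<pi>1 \<gamma>)"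
      "s \<cdot> k = t \<cdot> \<pi>1 \<gamma> \<cdot> y" for k y
    using that by simp
  let ?k = "\<pi>1 (T (T \<gamma>))" and ?p = "\<pi>2 (T (T \<gamma>))"
  have "\<langle>?h \<star> ?g, ?x\<rangle>\<^bsub>\<gamma>\<^esub> \<cdot> \<langle>?k \<star> (?h \<cdot> ?p), \<pi>2 (T \<gamma>) \<cdot> ?p\<rangle>\<^bsub>T \<gamma>\<^esub> =
      \<langle>(?k \<star> (?h \<cdot> ?p)) \<star> (?g \<cdot> ?p), ?x \<cdot> ?p\<rangle>\<^bsub>\<gamma>\<^esub>"
    by (subst mult_pair) simp_all
  also have "\<dots> = \<langle>?k \<star> (?h \<cdot> ?p) \<star> (?g \<cdot> ?p), ?x \<cdot> ?p\<rangle>\<^bsub>\<gamma>\<^esub>"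
    by simp
  also have "\<dots> = \<langle>?h \<star> ?g, ?x\<rangle>\<^bsub>\<gamma>\<^esub> \<cdot> \<langle>?k, \<langle>?h \<star> ?g, ?x\<rangle>\<^bsub>\<gamma>\<^esub> \<cdot> ?p\<rangle>\<^bsub>T \<gamma>\<^esub>"
    by (subst mult_pair) simp_all
  finally show "mult \<gamma> \<cdot>\<^bsub>\<B>\<^esub> mult (FObj \<T> \<gamma>) = mult \<gamma> \<cdot>\<^bsub>\<B>\<^esub> FArr \<T> (mult \<gamma>)"
    unfolding mult_def T_functor_FObj
    by (subst T_functor_FArr)
      (simp_all only: slice_simps comp_simps proj_simps D_simps simp_thms
        \<open>\<gamma> \<in> Arr C\<close> \<open>Cod C \<gamma> = D0 D\<close>)
qed


section \<open>Algebras are actions\<close>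

text \<open>The associativity law of an algebra compares two maps out of \<open>T (T \<gamma>)\<close>, whose elements are
  the triples \<open>(h, (g, x))\<close> of the associativity law of an action; it suffices to compare the maps
  on the generic such triple.\<close>

lemma algebra_assoc_iff:
  assumes \<gamma>: "\<gamma> \<in> Arr C" "Cod C \<gamma> = D0 D"
    and \<xi>: "\<xi> \<in> Arr C" "Dom C \<xi> = Dom C (\<pi>1 \<gamma>)" "Cod C \<xi> = Dom C \<gamma>" "\<gamma> \<cdot> \<xi> = T \<gamma>"
  shows "(T \<gamma>, \<gamma>, \<xi>) \<cdot>\<^bsub>\<B>\<^esub> mult \<gamma> = (T \<gamma>, \<gamma>, \<xi>) \<cdot>\<^bsub>\<B>\<^esub> FArr \<T> (T \<gamma>, \<gamma>, \<xi>) \<longleftrightarrow>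
         acts_associatively \<gamma> \<xi>" (is "?alg \<longleftrightarrow> _")
proof -
  let ?h = "\<pi>1 (T \<gamma>)" and ?g = "\<pi>1 \<gamma> \<cdot> \<pi>2 (T \<gamma>)" and ?x = "\<pi>2 \<gamma> \<cdot> \<pi>2 (T \<gamma>)"
  have alg: "?alg \<longleftrightarrow> \<xi> \<cdot> \<langle>?h \<star> ?g, ?x\<rangle>\<^bsub>\<gamma>\<^esub> = \<xi> \<cdot> \<langle>?h, \<xi> \<cdot> \<pi>2 (T \<gamma>)\<rangle>\<^bsub>\<gamma>\<^esub>"
    using \<gamma> by (simp add: mult_def)
  have \<xi>_over: "\<gamma> \<cdot> \<xi> \<cdot> w = t \<cdot> \<pi>1 \<gamma> \<cdot> w" if "w \<in> Arr C" "Cod C w = Dom C (\<pi>1 \<gamma>)" for w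
    using triangle[OF \<xi>(4), of w] that \<gamma> \<xi> by simp
  show ?thesis
  proof
    assume "acts_associatively \<gamma> \<xi>"
    then show ?alg
      using acts_associativelyD[of \<gamma> \<xi> ?h ?g ?x] \<gamma> unfolding alg by simp
  next
    assume generic: ?alg
    show "acts_associatively \<gamma> \<xi>"
      unfolding acts_associatively_def
    proof (intro allI impI, elim conjE)
      fix h g x
      assume [simp]: "h \<in> Arr C" "g \<in> Arr C" "x \<in> Arr C" "Cod C h = D1 D" "Cod C g = D1 D"
        "Cod C x = Dom C \<gamma>" "Dom C h = Dom C x" "Dom C g = Dom C x" "s \<cdot> h = t \<cdot> g" "s \<cdot> g = \<gamma> \<cdot> x"
      let ?w = "\<langle>h, \<langle>g, x\<rangle>\<^bsub>\<gamma>\<^esub>\<rangle>\<^bsub>T \<gamma>\<^esub>"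
      from generic have "(\<xi> \<cdot> \<langle>?h \<star> ?g, ?x\<rangle>\<^bsub>\<gamma>\<^esub>) \<cdot> ?w = (\<xi> \<cdot> \<langle>?h, \<xi> \<cdot> \<pi>2 (T \<gamma>)\<rangle>\<^bsub>\<gamma>\<^esub>) \<cdot> ?w"
        by (simp only: alg)
      then show "\<xi> \<cdot> \<langle>h \<star> g, x\<rangle>\<^bsub>\<gamma>\<^esub> = \<xi> \<cdot> \<langle>h, \<xi> \<cdot> \<langle>g, x\<rangle>\<^bsub>\<gamma>\<^esub>\<rangle>\<^bsub>\<gamma>\<^esub>"
        using \<gamma> \<xi> by (simp add: \<xi>_over)
    qed
  qed
qed

text \<open>The first two components of an algebra structure, an arrow of the slice, are forced: they are
  its domain and codomain.  The one remaining component is the action.\<close>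

lemma algebra_iff_action:
  "is_algebra \<B> \<T> unit mult (\<gamma>, a) \<longleftrightarrow>
     (\<exists>\<xi>. a = (T \<gamma>, \<gamma>, \<xi>) \<and> is_action C PB D (Dom C \<gamma>, \<gamma>, \<xi>))"
proof -
  have "is_algebra \<B> \<T> unit mult (\<gamma>, (\<alpha>, \<beta>, \<xi>)) \<longleftrightarrow>
      \<alpha> = T \<gamma> \<and> \<beta> = \<gamma> \<and> is_action C PB D (Dom C \<gamma>, \<gamma>, \<xi>)" for \<alpha> \<beta> \<xi>
  proof (cases "\<alpha> = T \<gamma> \<and> \<beta> = \<gamma> \<and> \<gamma> \<in> Arr C \<and> Cod C \<gamma> = D0 D \<and>
      \<xi> \<in> Arr C \<and> Dom C \<xi> = Dom C (\<pi>1 \<gamma>) \<and> Cod C \<xi> = Dom C \<gamma> \<and> \<gamma> \<cdot> \<xi> = T \<gamma>")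
    case True
    then have "(T \<gamma>, \<gamma>, \<xi>) \<cdot>\<^bsub>\<B>\<^esub> unit \<gamma> = Id \<B> \<gamma> \<longleftrightarrow>
        \<xi> \<cdot> \<langle>\<iota> \<cdot> \<gamma>, Id C (Dom C \<gamma>)\<rangle>\<^bsub>\<gamma>\<^esub> = Id C (Dom C \<gamma>)"
      by (simp add: unit_def)
    moreover note algebra_assoc_iff[of \<gamma> \<xi>] assoc_law_iff[of \<gamma> \<xi>]
    ultimately show ?thesis
      using True by (simp add: is_algebra_def is_action_def Hom_def[of C] del: T_functor_FArr)
  next
    case False
    then show ?thesis
      by (auto simp: is_algebra_def is_action_def Hom_def[of C])
  qed
  then show ?thesis by (cases a) auto
qed

lemma algebra_morphism_iff_action_morphism:
  assumes "is_action C PB D (Dom C \<gamma>, \<gamma>, \<xi>)" "is_action C PB D (Dom C \<gamma>', \<gamma>', \<xi>')"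
  shows "h \<in> Hom \<B> \<gamma> \<gamma>' \<and> h \<cdot>\<^bsub>\<B>\<^esub> (T \<gamma>, \<gamma>, \<xi>) = (T \<gamma>', \<gamma>', \<xi>') \<cdot>\<^bsub>\<B>\<^esub> FArr \<T> h \<longleftrightarrow>
    (\<exists>k. h = (\<gamma>, \<gamma>', k) \<and> is_action_morphism C PB D (Dom C \<gamma>, \<gamma>, \<xi>) (Dom C \<gamma>', \<gamma>', \<xi>') k)"
proof -
  have "\<gamma> \<in> Arr C" "Cod C \<gamma> = D0 D" "\<gamma>' \<in> Arr C" "Cod C \<gamma>' = D0 D"
    using assms by (simp_all add: is_action_def Hom_def)
  then have "(\<gamma>, \<gamma>', k) \<in> Hom \<B> \<gamma> \<gamma>' \<and>
        (\<gamma>, \<gamma>', k) \<cdot>\<^bsub>\<B>\<^esub> (T \<gamma>, \<gamma>, \<xi>) = (T \<gamma>', \<gamma>', \<xi>') \<cdot>\<^bsub>\<B>\<^esub> FArr \<T> (\<gamma>, \<gamma>', k) \<longleftrightarrow>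
      is_action_morphism C PB D (Dom C \<gamma>, \<gamma>, \<xi>) (Dom C \<gamma>', \<gamma>', \<xi>') k" for k
    by (simp add: is_action_morphism_def Hom_def[of C] pb_map_def conj_ac)
  moreover have "\<exists>k. h = (\<gamma>, \<gamma>', k)" if "h \<in> Hom \<B> \<gamma> \<gamma>'"
    using that by (cases h) simp
  ultimately show ?thesis by blast
qed

lemma Alg_isomorphic_Act: "isomorphic_categories (Alg \<B> \<T> unit mult) (Act C PB D)"
proof (rule isomorphic_categoriesI)
  let ?A = "Alg \<B> \<T> unit mult" and ?B = "Act C PB D"
  \<comment> \<open>The functor drops the domain and codomain recorded in the arrows of the slice and records the
    object \<open>Dom C \<gamma>\<close>; its inverse does the reverse.\<close>
  let ?FO = "\<lambda>(\<gamma>, a). (Dom C \<gamma>, \<gamma>, snd (snd a))" and ?GO = "\<lambda>(X, \<gamma>, \<xi>). (\<gamma>, T \<gamma>, \<gamma>, \<xi>)"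
  let ?FA = "\<lambda>(A, A', h). (?FO A, ?FO A', snd (snd h))"
  let ?GA = "\<lambda>(x, y, h). (?GO x, ?GO y, fst (snd x), fst (snd y), h)"
  have action_dom: "X = Dom C \<gamma>" if "is_action C PB D (X, \<gamma>, \<xi>)" for X \<gamma> \<xi>
    using that by (simp add: is_action_def Hom_def)
  show "category ?A" by (rule algebra_category) (rule T_monad)
  have Obj_Act: "x \<in> Obj ?B \<longleftrightarrow>
      (\<exists>\<gamma> \<xi>. x = (Dom C \<gamma>, \<gamma>, \<xi>) \<and> is_action C PB D (Dom C \<gamma>, \<gamma>, \<xi>))" for x
    by (cases x) (simp add: Act_def, metis action_dom)
  have Arr_Act: "f \<in> Arr ?B \<longleftrightarrow> (\<exists>\<gamma> \<xi> \<gamma>' \<xi>' k. f = ((Dom C \<gamma>, \<gamma>, \<xi>), (Dom C \<gamma>', \<gamma>', \<xi>'), k) \<and>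
      is_action C PB D (Dom C \<gamma>, \<gamma>, \<xi>) \<and> is_action C PB D (Dom C \<gamma>', \<gamma>', \<xi>') \<and>
      is_action_morphism C PB D (Dom C \<gamma>, \<gamma>, \<xi>) (Dom C \<gamma>', \<gamma>', \<xi>') k)" for f
  proof -
    obtain X \<gamma> \<xi> X' \<gamma>' \<xi>' k where f: "f = ((X, \<gamma>, \<xi>), (X', \<gamma>', \<xi>'), k)" by (metis surj_pair)
    show ?thesis
      by (simp add: f Act_def) (metis action_dom)
  qed
  have Obj_Alg: "x \<in> Obj ?A \<longleftrightarrow>
      (\<exists>\<gamma> \<xi>. x = (\<gamma>, T \<gamma>, \<gamma>, \<xi>) \<and> is_action C PB D (Dom C \<gamma>, \<gamma>, \<xi>))" for x
    by (cases x) (simp add: Alg_def algebra_iff_action)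
  have Arr_Alg: "f \<in> Arr ?A \<longleftrightarrow> (\<exists>\<gamma> \<xi> \<gamma>' \<xi>' k.
      f = ((\<gamma>, T \<gamma>, \<gamma>, \<xi>), (\<gamma>', T \<gamma>', \<gamma>', \<xi>'), (\<gamma>, \<gamma>', k)) \<and>
      is_action C PB D (Dom C \<gamma>, \<gamma>, \<xi>) \<and> is_action C PB D (Dom C \<gamma>', \<gamma>', \<xi>') \<and>
      is_action_morphism C PB D (Dom C \<gamma>, \<gamma>, \<xi>) (Dom C \<gamma>', \<gamma>', \<xi>') k)" for f
  proof -
    obtain \<gamma> a \<gamma>' a' h where f: "f = ((\<gamma>, a), (\<gamma>', a'), h)" by (metis surj_pair)
    have "f \<in> Arr ?A \<longleftrightarrow> (\<exists>\<xi> \<xi>'. a = (T \<gamma>, \<gamma>, \<xi>) \<and> a' = (T \<gamma>', \<gamma>', \<xi>') \<and>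
        is_action C PB D (Dom C \<gamma>, \<gamma>, \<xi>) \<and> is_action C PB D (Dom C \<gamma>', \<gamma>', \<xi>') \<and>
        h \<in> Hom \<B> \<gamma> \<gamma>' \<and> h \<cdot>\<^bsub>\<B>\<^esub> (T \<gamma>, \<gamma>, \<xi>) = (T \<gamma>', \<gamma>', \<xi>') \<cdot>\<^bsub>\<B>\<^esub> FArr \<T> h)"
      unfolding f Alg_def cat.simps mem_Collect_eq prod.case algebra_iff_action by blast
    also have "\<dots> \<longleftrightarrow> (\<exists>\<xi> \<xi>'. a = (T \<gamma>, \<gamma>, \<xi>) \<and> a' = (T \<gamma>', \<gamma>', \<xi>') \<and>
        is_action C PB D (Dom C \<gamma>, \<gamma>, \<xi>) \<and> is_action C PB D (Dom C \<gamma>', \<gamma>', \<xi>') \<and>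
        (\<exists>k. h = (\<gamma>, \<gamma>', k) \<and>
           is_action_morphism C PB D (Dom C \<gamma>, \<gamma>, \<xi>) (Dom C \<gamma>', \<gamma>', \<xi>') k))"
      by (intro ex_cong1 conj_cong refl algebra_morphism_iff_action_morphism)
    finally show ?thesis unfolding f prod.inject by blast
  qed
  show "bij_betw ?FO (Obj ?A) (Obj ?B)"
    by (rule bij_betw_byWitness[where f' = ?GO]) (auto simp: Obj_Alg Obj_Act)
  show "bij_betw ?FA (Arr ?A) (Arr ?B)"
    by (rule bij_betw_byWitness[where f' = ?GA]) (auto simp: Arr_Alg Arr_Act)
  show "Dom ?B (?FA f) = ?FO (Dom ?A f) \<and> Cod ?B (?FA f) = ?FO (Cod ?A f)" if "f \<in> Arr ?A" for f
    using that by (auto simp: Alg_def Act_def)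
  show "?FA (Id ?A x) = Id ?B (?FO x)" if "x \<in> Obj ?A" for x
    by (cases x) (simp add: Alg_def Act_def)
  show "?FA (g \<cdot>\<^bsub>?A\<^esub> f) = ?FA g \<cdot>\<^bsub>?B\<^esub> ?FA f" if "f \<in> Arr ?A" "g \<in> Arr ?A" for f g
    using that by (auto simp: Arr_Alg) (simp add: Alg_def Act_def)
qed

end

theorem theorem3p2:
  fixes C :: "('o, 'a) cat" and PB :: "'a pb_choice" and D :: "('o, 'a) internal_cat"
  assumes "category C" and "has_finite_limits C"
    and "pullback_choice C PB"
    and "internal_category C PB D"
  shows "\<exists>\<eta> \<mu>. monad (slice C (D0 D)) (T_functor C PB D) \<eta> \<mu> \<and>
           isomorphic_categories (Alg (slice C (D0 D)) (T_functor C PB D) \<eta> \<mu>) (Act C PB D)"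
proof -
  interpret internal_category_in C PB D
    using assms by (simp add: internal_category_in_def category_with_pullbacks_def
        category_with_pullbacks_axioms_def internal_category_in_axioms_def)
  show ?thesis
    using T_monad Alg_isomorphic_Act by blast
qed

end
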